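(* Let $R$ be a nonzero commutative ring with unit and let $M$ be an $R$-orientable $n$-manifold without boundary with a continuous flow. Assume that $K\subseteq M$ is a connected isolated unstable attractor with only internal explosions. Then there exist $r$ independent (i.e. $R$-linearly independent) cohomology classes $\alpha_1,\ldots,\alpha_r\in H^1(M;R)$ such that $\alpha_i\smile\alpha_j=0$ for all $1\le i,j\le r$, where $r\ge1$ is the number of homoclinic components of $\mathcal{A}(K)-K$.
   Context: Manifolds are topological and metrizable. A continuous flow is a continuous action $M\times\mathbb{R}\to M$, $(x,t)\mapsto x\cdot t$; $\omega(x)$ is the usual limit set, and $J^{+}(x)=\bigcap_{U,\,t\ge 0}\overline{U\cdot[t,+\infty)}$, where $U$ ranges over the open neighbourhoods of $x$. A compact invariant set $K$ is isolated if it has a compact neighbourhood $N$ such that $K=\{x\in N: x\cdot\mathbb{R}\subseteq N\}$. An isolated attractor is an isolated compact invariant set $K$ such that its basin of attraction $\mathcal{A}(K)=\{x\in M:\emptyset\ne\omega(x)\subseteq K\}$ is a neighbourhood of $K$; it is stable if it has a neighbourhood basis of positively invariant sets, and unstable otherwise. $K$ has only internal explosions if $J^{+}(x)\subseteq K$ for all $x\in\mathcal{A}(K)-K$. In that case $\mathcal{A}(K)-K$ has finitely many connected components, each of which is either contained in or disjoint from $\widehat K=\bigcup_{x\in K}J^{+}(x)$; those contained in $\widehat K$ (equivalently, consisting of points $x$ with $\emptyset\ne\alpha(x)\subseteq K$) are called homoclinic components. $H^*$ is singular cohomology and $\smile$ the cup product. *)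

theory Defs
  imports "HOL-Homology.Homology" "HOL-Algebra.Module" "HOL-Analysis.Abstract_Metric_Spaces"
begin

section \<open>Manifolds and continuous flows\<close>

definition topological_manifold :: "nat \<Rightarrow> 'a topology \<Rightarrow> bool" where
  "topological_manifold n M \<longleftrightarrow>
     metrizable_space M \<and>
     (\<forall>x\<in>topspace M. \<exists>U. openin M U \<and> x \<in> U \<and> subtopology M U homeomorphic_space Euclidean_space n)"

definition continuous_flow :: "'a topology \<Rightarrow> ('a \<Rightarrow> real \<Rightarrow> 'a) \<Rightarrow> bool" where
  "continuous_flow M \<phi> \<longleftrightarrow>
     continuous_map (prod_topology M euclideanreal) M (\<lambda>(x, t). \<phi> x t) \<and>
     (\<forall>x\<in>topspace M. \<phi> x 0 = x) \<and>
     (\<forall>x\<in>topspace M. \<forall>s t. \<phi> (\<phi> x s) t = \<phi> x (s + t))"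

definition omega_limit :: "'a topology \<Rightarrow> ('a \<Rightarrow> real \<Rightarrow> 'a) \<Rightarrow> 'a \<Rightarrow> 'a set" where
  "omega_limit M \<phi> x = (\<Inter>t\<in>{0..}. M closure_of (\<phi> x ` {t..}))"

definition prolongational_limit :: "'a topology \<Rightarrow> ('a \<Rightarrow> real \<Rightarrow> 'a) \<Rightarrow> 'a \<Rightarrow> 'a set" where
  "prolongational_limit M \<phi> x =
     (\<Inter>U\<in>{U. openin M U \<and> x \<in> U}. \<Inter>t\<in>{0..}. M closure_of {\<phi> y s | y s. y \<in> U \<and> t \<le> s})"

definition neighbourhood_of_set :: "'a topology \<Rightarrow> 'a set \<Rightarrow> 'a set \<Rightarrow> bool" where
  "neighbourhood_of_set M K N \<longleftrightarrow> N \<subseteq> topspace M \<and> K \<subseteq> M interior_of N"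

definition invariant_set :: "'a topology \<Rightarrow> ('a \<Rightarrow> real \<Rightarrow> 'a) \<Rightarrow> 'a set \<Rightarrow> bool" where
  "invariant_set M \<phi> K \<longleftrightarrow> K \<subseteq> topspace M \<and> (\<forall>x\<in>K. \<forall>t. \<phi> x t \<in> K)"

definition positively_invariant_set :: "'a topology \<Rightarrow> ('a \<Rightarrow> real \<Rightarrow> 'a) \<Rightarrow> 'a set \<Rightarrow> bool" where
  "positively_invariant_set M \<phi> K \<longleftrightarrow> K \<subseteq> topspace M \<and> (\<forall>x\<in>K. \<forall>t\<ge>0. \<phi> x t \<in> K)"

definition isolated_compact_invariant :: "'a topology \<Rightarrow> ('a \<Rightarrow> real \<Rightarrow> 'a) \<Rightarrow> 'a set \<Rightarrow> bool" where
  "isolated_compact_invariant M \<phi> K \<longleftrightarrow>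
     compactin M K \<and> invariant_set M \<phi> K \<and>
     (\<exists>N. compactin M N \<and> neighbourhood_of_set M K N \<and> K = {x\<in>N. \<forall>t. \<phi> x t \<in> N})"

definition basin :: "'a topology \<Rightarrow> ('a \<Rightarrow> real \<Rightarrow> 'a) \<Rightarrow> 'a set \<Rightarrow> 'a set" where
  "basin M \<phi> K = {x\<in>topspace M. omega_limit M \<phi> x \<noteq> {} \<and> omega_limit M \<phi> x \<subseteq> K}"

definition isolated_attractor :: "'a topology \<Rightarrow> ('a \<Rightarrow> real \<Rightarrow> 'a) \<Rightarrow> 'a set \<Rightarrow> bool" where
  "isolated_attractor M \<phi> K \<longleftrightarrow>
     isolated_compact_invariant M \<phi> K \<and> neighbourhood_of_set M K (basin M \<phi> K)"

definition stable_set :: "'a topology \<Rightarrow> ('a \<Rightarrow> real \<Rightarrow> 'a) \<Rightarrow> 'a set \<Rightarrow> bool" where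
  "stable_set M \<phi> K \<longleftrightarrow>
     (\<forall>N. neighbourhood_of_set M K N \<longrightarrow>
        (\<exists>P. P \<subseteq> N \<and> neighbourhood_of_set M K P \<and> positively_invariant_set M \<phi> P))"

definition only_internal_explosions :: "'a topology \<Rightarrow> ('a \<Rightarrow> real \<Rightarrow> 'a) \<Rightarrow> 'a set \<Rightarrow> bool" where
  "only_internal_explosions M \<phi> K \<longleftrightarrow>
     (\<forall>x \<in> basin M \<phi> K - K. prolongational_limit M \<phi> x \<subseteq> K)"

definition prolongation_hull :: "'a topology \<Rightarrow> ('a \<Rightarrow> real \<Rightarrow> 'a) \<Rightarrow> 'a set \<Rightarrow> 'a set" where
  "prolongation_hull M \<phi> K = (\<Union>x\<in>K. prolongational_limit M \<phi> x)"

definition homoclinic_components :: "'a topology \<Rightarrow> ('a \<Rightarrow> real \<Rightarrow> 'a) \<Rightarrow> 'a set \<Rightarrow> 'a set set" where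
  "homoclinic_components M \<phi> K =
     {C \<in> connected_components_of (subtopology M (basin M \<phi> K - K)). C \<subseteq> prolongation_hull M \<phi> K}"


section \<open>Modules over a commutative ring given as a type\<close>

text \<open>
  The coefficient ring is a type of class \<^class>\<open>comm_ring_1\<close>, which includes \<open>0 \<noteq> 1\<close>.
  Modules over it are records of type \<open>('r, 'v) module\<close>; their fields
  \<open>mult\<close> and \<open>one\<close> carry no meaning.
\<close>

text \<open>The module \<open>(Z + B) / B\<close>, for submodules \<open>Z\<close> and \<open>B\<close> of \<open>C\<close>.\<close>

definition subquotient_module :: "('r, 'v) module \<Rightarrow> 'v set \<Rightarrow> 'v set \<Rightarrow> ('r, 'v set) module" where
  "subquotient_module C Z B =
     \<lparr>carrier = (\<lambda>z. B +>\<^bsub>C\<^esub> z) ` Z, mult = undefined, one = undefined,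
      zero = B, add = (\<lambda>A A'. A <+>\<^bsub>C\<^esub> A'),
      smult = (\<lambda>a A. \<Union>z\<in>A. B +>\<^bsub>C\<^esub> (a \<odot>\<^bsub>C\<^esub> z))\<rparr>"

definition module_independent :: "('r::comm_ring_1, 'v) module \<Rightarrow> 'i set \<Rightarrow> ('i \<Rightarrow> 'v) \<Rightarrow> bool" where
  "module_independent V I v \<longleftrightarrow> v \<in> I \<rightarrow> carrier V \<and>
     (\<forall>c J. finite J \<and> J \<subseteq> I \<and> (\<Oplus>\<^bsub>V\<^esub>i\<in>J. c i \<odot>\<^bsub>V\<^esub> v i) = \<zero>\<^bsub>V\<^esub> \<longrightarrow> (\<forall>i\<in>J. c i = 0))"


section \<open>Singular homology with coefficients and orientability\<close>

type_synonym 'a sing_simplex = "(nat \<Rightarrow> real) \<Rightarrow> 'a"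

definition coeff_chain_module ::
    "nat \<Rightarrow> 'a topology \<Rightarrow> ('r::comm_ring_1, 'a sing_simplex \<Rightarrow>\<^sub>0 'r) module" where
  "coeff_chain_module p X =
     \<lparr>carrier = {c. Poly_Mapping.keys c \<subseteq> singular_simplex_set p X}, mult = undefined, one = undefined,
      zero = 0, add = (+), smult = (\<lambda>a. Poly_Mapping.map ((*) a))\<rparr>"

definition coeff_boundary ::
    "nat \<Rightarrow> ('a sing_simplex \<Rightarrow>\<^sub>0 'r) \<Rightarrow> ('a sing_simplex \<Rightarrow>\<^sub>0 'r::comm_ring_1)" where
  "coeff_boundary p c =
     (if p = 0 then 0 else
      \<Sum>f\<in>Poly_Mapping.keys c. \<Sum>k\<le>p.
        Poly_Mapping.single (singular_face p k f) ((-1) ^ k * Poly_Mapping.lookup c f))"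

definition coeff_relcycles ::
    "nat \<Rightarrow> 'a topology \<Rightarrow> 'a set \<Rightarrow> ('a sing_simplex \<Rightarrow>\<^sub>0 'r::comm_ring_1) set" where
  "coeff_relcycles p X S =
     {c \<in> carrier (coeff_chain_module p X).
        coeff_boundary p c \<in> carrier (coeff_chain_module (p - 1) (subtopology X S))}"

definition coeff_relboundaries ::
    "nat \<Rightarrow> 'a topology \<Rightarrow> 'a set \<Rightarrow> ('a sing_simplex \<Rightarrow>\<^sub>0 'r::comm_ring_1) set" where
  "coeff_relboundaries p X S =
     {coeff_boundary (Suc p) d + e | d e.
        d \<in> carrier (coeff_chain_module (Suc p) X) \<and>
        e \<in> carrier (coeff_chain_module p (subtopology X S))}"

definition coeff_homology ::
    "nat \<Rightarrow> 'a topology \<Rightarrow> 'a set \<Rightarrow> ('r::comm_ring_1, ('a sing_simplex \<Rightarrow>\<^sub>0 'r) set) module" where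
  "coeff_homology p X S =
     subquotient_module (coeff_chain_module p X) (coeff_relcycles p X S) (coeff_relboundaries p X S)"

text \<open>The map induced in homology by an inclusion of pairs from \<open>(X, S)\<close> to \<open>(X, T)\<close>, \<open>S \<subseteq> T\<close>.\<close>

definition coeff_homology_incl ::
    "nat \<Rightarrow> 'a topology \<Rightarrow> 'a set \<Rightarrow> ('a sing_simplex \<Rightarrow>\<^sub>0 'r::comm_ring_1) set
      \<Rightarrow> ('a sing_simplex \<Rightarrow>\<^sub>0 'r) set" where
  "coeff_homology_incl p X T A =
     (\<Union>z\<in>A. coeff_relboundaries p X T +>\<^bsub>coeff_chain_module p X\<^esub> z)"

text \<open>
  \<open>\<mu>\<close> picks a generator of each local homology module; local consistency is required on some open
  neighbourhood \<open>U\<close> of each point. Restricting the class \<open>A\<close> to a coordinate ball inside \<open>U\<close>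
  gives the formulation in terms of balls.
\<close>

definition R_orientation ::
    "nat \<Rightarrow> 'a topology \<Rightarrow> ('a \<Rightarrow> ('a sing_simplex \<Rightarrow>\<^sub>0 'r::comm_ring_1) set) \<Rightarrow> bool" where
  "R_orientation n M \<mu> \<longleftrightarrow>
     (\<forall>x\<in>topspace M.
        let H = coeff_homology n M (topspace M - {x})
        in \<mu> x \<in> carrier H \<and> carrier H = range (\<lambda>a. a \<odot>\<^bsub>H\<^esub> \<mu> x)) \<and>
     (\<forall>x\<in>topspace M. \<exists>U. openin M U \<and> x \<in> U \<and>
        (\<exists>A \<in> carrier (coeff_homology n M (topspace M - U)).
           \<forall>y\<in>U. coeff_homology_incl n M (topspace M - {y}) A = \<mu> y))"

definition R_orientable :: "'r::comm_ring_1 itself \<Rightarrow> nat \<Rightarrow> 'a topology \<Rightarrow> bool" where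
  "R_orientable _ n M \<longleftrightarrow>
     (\<exists>\<mu> :: 'a \<Rightarrow> ('a sing_simplex \<Rightarrow>\<^sub>0 'r) set. R_orientation n M \<mu>)"


section \<open>Singular cohomology with coefficients and the cup product\<close>

text \<open>
  A \<open>p\<close>-cochain, that is a homomorphism from the \<open>p\<close>-chains to the coefficients, is represented by
  its values on singular \<open>p\<close>-simplices, extended by 0 to arguments that are not such simplices.
\<close>

definition cochain_module ::
    "nat \<Rightarrow> 'a topology \<Rightarrow> ('r::comm_ring_1, 'a sing_simplex \<Rightarrow> 'r) module" where
  "cochain_module p X =
     \<lparr>carrier = {u. \<forall>f. \<not> singular_simplex p X f \<longrightarrow> u f = 0}, mult = undefined, one = undefined,
      zero = (\<lambda>f. 0), add = (\<lambda>u v f. u f + v f), smult = (\<lambda>a u f. a * u f)\<rparr>"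

definition coboundary ::
    "nat \<Rightarrow> 'a topology \<Rightarrow> ('a sing_simplex \<Rightarrow> 'r) \<Rightarrow> ('a sing_simplex \<Rightarrow> 'r::comm_ring_1)" where
  "coboundary p X u =
     (\<lambda>f. if singular_simplex (Suc p) X f
          then \<Sum>k\<le>Suc p. (-1) ^ k * u (singular_face (Suc p) k f) else 0)"

definition cocycles :: "nat \<Rightarrow> 'a topology \<Rightarrow> ('a sing_simplex \<Rightarrow> 'r::comm_ring_1) set" where
  "cocycles p X = {u \<in> carrier (cochain_module p X). coboundary p X u = (\<lambda>f. 0)}"

definition coboundaries :: "nat \<Rightarrow> 'a topology \<Rightarrow> ('a sing_simplex \<Rightarrow> 'r::comm_ring_1) set" where
  "coboundaries p X =
     (case p of 0 \<Rightarrow> {\<lambda>f. 0} | Suc q \<Rightarrow> coboundary q X ` carrier (cochain_module q X))"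

definition singular_cohomology ::
    "nat \<Rightarrow> 'a topology \<Rightarrow> ('r::comm_ring_1, ('a sing_simplex \<Rightarrow> 'r) set) module" where
  "singular_cohomology p X = subquotient_module (cochain_module p X) (cocycles p X) (coboundaries p X)"

definition front_face :: "nat \<Rightarrow> 'a sing_simplex \<Rightarrow> 'a sing_simplex" where
  "front_face p f = restrict f (standard_simplex p)"

text \<open>The back face is \<open>f\<close> restricted to the vertices \<open>p, \<dots>, p + q\<close> of the standard simplex.\<close>

definition back_face :: "nat \<Rightarrow> nat \<Rightarrow> 'a sing_simplex \<Rightarrow> 'a sing_simplex" where
  "back_face p q f = restrict (\<lambda>x. f (\<lambda>i. if i < p then 0 else x (i - p))) (standard_simplex q)"

definition cochain_cup ::
    "nat \<Rightarrow> nat \<Rightarrow> 'a topology \<Rightarrow> ('a sing_simplex \<Rightarrow> 'r) \<Rightarrow> ('a sing_simplex \<Rightarrow> 'r)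
      \<Rightarrow> ('a sing_simplex \<Rightarrow> 'r::comm_ring_1)" where
  "cochain_cup p q X u v =
     (\<lambda>f. if singular_simplex (p + q) X f then u (front_face p f) * v (back_face p q f) else 0)"

text \<open>
  The union below is over all representatives; by the Leibniz rule the class of the product
  does not depend on them.
\<close>

definition cup_product ::
    "nat \<Rightarrow> nat \<Rightarrow> 'a topology \<Rightarrow> ('a sing_simplex \<Rightarrow> 'r) set \<Rightarrow> ('a sing_simplex \<Rightarrow> 'r) set
      \<Rightarrow> ('a sing_simplex \<Rightarrow> 'r::comm_ring_1) set" where
  "cup_product p q X A B =
     (\<Union>u\<in>A. \<Union>v\<in>B. coboundaries (p + q) X +>\<^bsub>cochain_module (p + q) X\<^esub> cochain_cup p q X u v)"

end

theory Submission
  imports Defs "HOL-Analysis.Analysis"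
begin

text \<open>
  On \<open>C = basin - K\<close> the absence of external explosions means that a compact subset of \<open>C\<close> is left
  for good after a bounded time, and every orbit in \<open>C\<close> meets the compact frontier of an isolating
  neighbourhood of \<open>K\<close>. Averaging a bump function along the orbits gives a continuous \<open>\<theta>\<close> on \<open>C\<close> with
  \<open>\<theta> (\<phi> x s) = \<theta> x + s\<close> and compact slabs \<open>\<bar>\<theta>\<bar> \<le> b\<close>. Hence \<open>C\<close> has finitely many components, each of
  the form section times line. If no component came out of \<open>K\<close> in negative time, then
  \<open>K \<union> {\<theta> > m}\<close> would be a basis of positively invariant neighbourhoods of \<open>K\<close>; so \<open>r \<ge> 1\<close>.

  The class of a homoclinic component counts the signed crossings of its section \<open>\<theta> = 0\<close>. A loop
  that follows an orbit of one homoclinic component from near \<open>K\<close> to near \<open>K\<close> and closes up near the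
  connected set \<open>K\<close> crosses exactly this section, once, which gives independence. The sections are
  disjoint and two-sided, so the classes come from a bouquet of circles, where cup products of
  classes of degree one vanish; concretely, the product is cobounded by an iterated crossing number.
\<close>

section \<open>Primitives of locally defined cocycles\<close>

text \<open>A singular simplex is merely continuous: a path may touch a section infinitely often,
  and a section is not known to be a submanifold, so crossings cannot be counted by general
  position. They are encoded as an Alexander-Spanier cocycle, a function \<open>c p q\<close> of
  pairs of nearby points. The crossing number of a path is the growth of a primitive of
  \<open>c\<close> along it; on a simplex a primitive exists by convexity and compactness.

  The square of a class is the delicate product. Graded commutativity yields only that twice the
  square vanishes, which says nothing when 2 = 0 in the ring. Hence the explicit primitive of the
  product cochain, obtained from a second cocycle that is twisted by a primitive of the first.

  The path that closes up a loop has to avoid all sections at once. For this the slabs must be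
  closed in the whole manifold and not only in \<open>C\<close>; their compactness provides
  that.\<close>

definition local_primitive ::
    "'b::metric_space set \<Rightarrow> ('b \<Rightarrow> 'b \<Rightarrow> 'r::ab_group_add) \<Rightarrow> ('b \<Rightarrow> 'r) \<Rightarrow> bool" where
  "local_primitive D c F \<longleftrightarrow>
     (\<forall>x\<in>D. \<exists>d>0. \<forall>p\<in>D \<inter> ball x d. \<forall>q\<in>D \<inter> ball x d. F q - F p = c p q)"

definition local_cocycle ::
    "'b::metric_space set \<Rightarrow> ('b \<Rightarrow> 'b \<Rightarrow> 'r::ab_group_add) \<Rightarrow> bool" where
  "local_cocycle D c \<longleftrightarrow>
     (\<forall>x\<in>D. \<exists>d>0. \<forall>p\<in>D \<inter> ball x d. \<forall>q\<in>D \<inter> ball x d. \<forall>s\<in>D \<inter> ball x d. c p q + c q s = c p s)"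

text \<open>
  Sum \<open>c\<close> along a fine subdivision of the segment from a base point to \<open>x\<close>. For two close endpoints
  the two segments are compared rung by rung.
\<close>

lemma local_primitive_exists:
  fixes D :: "'b::real_normed_vector set"
  assumes "convex D" "compact D" and c: "local_cocycle D c"
  obtains F where "local_primitive D c F"
proof (cases "D = {}")
  case True
  then show ?thesis
    using that by (auto simp: local_primitive_def)
next
  case False
  then obtain p where p: "p \<in> D" by blast
  define good where
    "good e x \<longleftrightarrow> (\<forall>p\<in>D \<inter> ball x e. \<forall>q\<in>D \<inter> ball x e. \<forall>s\<in>D \<inter> ball x e. c p q + c q s = c p s)" for e x
  define \<G> where "\<G> = {ball x e | x e. x \<in> D \<and> 0 < e \<and> good e x}"
  have "D \<subseteq> \<Union>\<G>"
  proof
    fix x assume x: "x \<in> D"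
    then obtain e where "e > 0" "good e x"
      using c unfolding local_cocycle_def good_def by blast
    then show "x \<in> \<Union>\<G>"
      using x unfolding \<G>_def by (auto intro!: exI[of _ "ball x e"])
  qed
  moreover have "\<And>G. G \<in> \<G> \<Longrightarrow> open G"
    by (auto simp: \<G>_def)
  ultimately obtain e where e: "e > 0" and "\<And>x. x \<in> D \<Longrightarrow> \<exists>G\<in>\<G>. ball x e \<subseteq> G"
    using Heine_Borel_lemma[OF \<open>compact D\<close>] by metis
  \<comment> \<open>\<open>e\<close> is a Lebesgue number of the cover, so one radius now serves for
    every centre in \<open>D\<close>.\<close>
  then have good: "good e x" if "x \<in> D" for x
    using that unfolding \<G>_def good_def by blast
  have triple: "c u v + c v w = c u w"
    if "u \<in> D" "v \<in> D" "w \<in> D" "dist u v < e" "dist u w < e" for u v w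
    using good[OF that(1)] that \<open>e > 0\<close> unfolding good_def by auto
  have diag: "c u u = 0" if "u \<in> D" for u
    using triple[of u u u] that \<open>e > 0\<close> by simp
  obtain B where B: "\<And>x. x \<in> D \<Longrightarrow> dist p x \<le> B"
    using compact_imp_bounded[OF \<open>compact D\<close>] bounded_any_center by metis
  \<comment> \<open>With more than \<open>2 * B / e\<close> pieces each piece of a segment is
    shorter than \<open>e / 2\<close>. The diagonal of a rung, one piece plus one side, then stays
    below \<open>e\<close>.\<close>
  obtain N0 :: nat where N0: "2 * B / e < real N0"
    using reals_Archimedean2 by blast
  define N where "N = Suc N0"
  have N: "2 * B / e < real N" "N > 0"
    using N0 by (auto simp: N_def)
  define pt where "pt x k = p + (real k / real N) *\<^sub>R (x - p)" for x k
  have pt_D: "pt x k \<in> D" if "x \<in> D" "k \<le> N" for x k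
  proof -
    have "pt x k = (1 - real k / real N) *\<^sub>R p + (real k / real N) *\<^sub>R x"
      by (simp add: pt_def algebra_simps)
    moreover have "0 \<le> real k / real N" "real k / real N \<le> 1"
      using that N by auto
    ultimately show ?thesis
      using convexD_alt[OF \<open>convex D\<close> p that(1)] by simp
  qed
  have step: "dist (pt x k) (pt x (Suc k)) < e / 2" if "x \<in> D" for x k
  proof -
    have "pt x k - pt x (Suc k) = - ((1 / real N) *\<^sub>R (x - p))"
      by (simp add: pt_def algebra_simps add_divide_distrib)
    then have "dist (pt x k) (pt x (Suc k)) = (1 / real N) * dist p x"
      by (simp add: dist_norm norm_minus_commute)
    also have "\<dots> \<le> (1 / real N) * B"
      using B[OF that] by (intro mult_left_mono) auto
    also have "\<dots> < e / 2"
      using N e by (simp add: field_simps)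
    finally show ?thesis .
  qed
  have side: "dist (pt x k) (pt y k) \<le> dist x y" if "k \<le> N" for x y k
  proof -
    have "pt x k - pt y k = (real k / real N) *\<^sub>R (x - y)"
      by (simp add: pt_def algebra_simps)
    then have "dist (pt x k) (pt y k) = (real k / real N) * dist x y"
      by (simp add: dist_norm)
    also have "\<dots> \<le> 1 * dist x y"
      using that N by (intro mult_right_mono) auto
    finally show ?thesis by simp
  qed
  define P where "P x m = (\<Sum>k<m. c (pt x k) (pt x (Suc k)))" for x m
  have ladder: "P x m + c (pt x m) (pt y m) = P y m"
    if xy: "x \<in> D" "y \<in> D" "dist x y < e / 2" and m: "m \<le> N" for x y m
    using m
  proof (induction m)
    case 0
    then show ?case
      using p diag by (simp add: P_def pt_def)
  next
    case (Suc m)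
    have m: "m \<le> N" "Suc m \<le> N" using Suc.prems by auto
    note inD = pt_D[OF xy(1) m(1)] pt_D[OF xy(1) m(2)] pt_D[OF xy(2) m(1)] pt_D[OF xy(2) m(2)]
    have far: "dist (pt x m) (pt y (Suc m)) < e"
      using dist_triangle[of "pt x m" "pt y (Suc m)" "pt x (Suc m)"] step[OF xy(1), of m]
        side[OF m(2), of x y] xy(3) by linarith
    have 1: "c (pt x m) (pt x (Suc m)) + c (pt x (Suc m)) (pt y (Suc m)) = c (pt x m) (pt y (Suc m))"
      using step[OF xy(1), of m] far inD e by (intro triple) auto
    have 2: "c (pt x m) (pt y m) + c (pt y m) (pt y (Suc m)) = c (pt x m) (pt y (Suc m))"
      using side[OF m(1), of x y] xy(3) far inD e by (intro triple) auto
    have "P x (Suc m) + c (pt x (Suc m)) (pt y (Suc m)) = P x m + c (pt x m) (pt y (Suc m))"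
      by (simp add: P_def add.assoc 1)
    also have "\<dots> = P y m + c (pt y m) (pt y (Suc m))"
      using Suc.IH m(1) by (simp add: 2[symmetric] flip: add.assoc)
    finally show ?case
      by (simp add: P_def)
  qed
  have F_diff: "P y N - P x N = c x y" if "x \<in> D" "y \<in> D" "dist x y < e / 2" for x y
    using ladder[OF that order_refl] N(2) by (simp add: pt_def algebra_simps)
  have "local_primitive D c (\<lambda>x. P x N)"
    unfolding local_primitive_def
  proof (intro ballI exI[of _ "e / 4"] conjI)
    fix x u v assume "x \<in> D" "u \<in> D \<inter> ball x (e / 4)" "v \<in> D \<inter> ball x (e / 4)"
    then show "P v N - P u N = c u v"
      using dist_triangle3[of u v x] by (intro F_diff) auto
  qed (use e in auto)
  then show ?thesis by (rule that)
qed

text \<open>\<open>F - G\<close> is locally constant, hence constant on a connected set. This makes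
  increments of primitives independent of every choice.\<close>

lemma local_primitive_unique:
  assumes "connected D" and F: "local_primitive D c F" and G: "local_primitive D c G"
    and "p \<in> D" "q \<in> D"
  shows "F q - F p = G q - G p"
proof -
  have "(\<lambda>x. F x - G x) constant_on D"
  proof (rule locally_constant_imp_constant[OF \<open>connected D\<close>])
    fix a assume a: "a \<in> D"
    obtain d where d: "d > 0" "\<And>p q. p \<in> D \<inter> ball a d \<Longrightarrow> q \<in> D \<inter> ball a d \<Longrightarrow> F q - F p = c p q"
      using F a unfolding local_primitive_def by blast
    obtain e where e: "e > 0" "\<And>p q. p \<in> D \<inter> ball a e \<Longrightarrow> q \<in> D \<inter> ball a e \<Longrightarrow> G q - G p = c p q"
      using G a unfolding local_primitive_def by blast
    have eq: "F x - G x = F a - G a" if "x \<in> D \<inter> ball a (min d e)" for x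
    proof -
      have "F x - F a = G x - G a"
        using d(2)[of a x] e(2)[of a x] that a d(1) e(1) by simp
      then show ?thesis
        by (metis add.commute diff_add_cancel diff_diff_eq2)
    qed
    have "openin (top_of_set D) (D \<inter> ball a (min d e))"
      by (intro openin_open_Int open_ball)
    moreover have "a \<in> D \<inter> ball a (min d e)"
      using a d(1) e(1) by simp
    ultimately show "\<exists>T. openin (top_of_set D) T \<and> a \<in> T \<and> (\<forall>x\<in>T. F x - G x = F a - G a)"
      using eq by blast
  qed
  then have "F q - G q = F p - G p"
    using assms(4,5) unfolding constant_on_def by auto
  then show ?thesis
    by (simp add: algebra_simps)
qed

text \<open>Serves to restrict primitives on a triangle to its three edges.\<close>

lemma local_primitive_compose:
  assumes F: "local_primitive D c F" and g: "continuous_on E g" "g \<in> E \<rightarrow> D"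
  shows "local_primitive E (\<lambda>x y. c (g x) (g y)) (\<lambda>x. F (g x))"
  unfolding local_primitive_def
proof
  fix x assume x: "x \<in> E"
  then obtain d where d: "d > 0"
    and Fd: "\<And>p q. p \<in> D \<inter> ball (g x) d \<Longrightarrow> q \<in> D \<inter> ball (g x) d \<Longrightarrow> F q - F p = c p q"
    using F g unfolding local_primitive_def by blast
  obtain e where e: "e > 0" "\<And>y. y \<in> E \<Longrightarrow> dist y x < e \<Longrightarrow> dist (g y) (g x) < d"
    using g(1) x d unfolding continuous_on_iff by metis
  have "F (g q) - F (g p) = c (g p) (g q)" if "p \<in> E \<inter> ball x e" "q \<in> E \<inter> ball x e" for p q
    using that e(2) g(2) by (intro Fd) (auto simp: dist_commute)
  then show "\<exists>d>0. \<forall>p\<in>E \<inter> ball x d. \<forall>q\<in>E \<inter> ball x d. F (g q) - F (g p) = c (g p) (g q)"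
    using e(1) by blast
qed

section \<open>Singular cohomology as a module\<close>

lemma cochain_module_simps [simp]:
  "carrier (cochain_module p X) = {u. \<forall>f. \<not> singular_simplex p X f \<longrightarrow> u f = 0}"
  "\<zero>\<^bsub>cochain_module p X\<^esub> = (\<lambda>f. 0)"
  "u \<oplus>\<^bsub>cochain_module p X\<^esub> v = (\<lambda>f. u f + v f)"
  "a \<odot>\<^bsub>cochain_module p X\<^esub> u = (\<lambda>f. a * u f)"
  by (simp_all add: cochain_module_def)

lemma coboundary_linear:
  "coboundary p X (\<lambda>f. u f + v f) = (\<lambda>f. coboundary p X u f + coboundary p X v f)"
  "coboundary p X (\<lambda>f. a * u f) = (\<lambda>f. a * coboundary p X u f)"
  "coboundary p X (\<lambda>f. 0) = (\<lambda>f. 0)"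
  by (auto simp: coboundary_def fun_eq_iff sum.distrib sum_distrib_left algebra_simps)

lemma cocycles_closed:
  "(\<lambda>f. 0) \<in> cocycles p X"
  "u \<in> cocycles p X \<Longrightarrow> v \<in> cocycles p X \<Longrightarrow> (\<lambda>f. u f + v f) \<in> cocycles p X"
  "u \<in> cocycles p X \<Longrightarrow> (\<lambda>f. a * u f) \<in> cocycles p X"
  by (auto simp: cocycles_def coboundary_linear fun_eq_iff)

lemma coboundaries_closed:
  "(\<lambda>f. 0) \<in> coboundaries p X"
  "u \<in> coboundaries p X \<Longrightarrow> v \<in> coboundaries p X \<Longrightarrow> (\<lambda>f. u f + v f) \<in> coboundaries p X"
  "u \<in> coboundaries p X \<Longrightarrow> (\<lambda>f. a * u f) \<in> coboundaries p X"
proof -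
  show "(\<lambda>f. 0) \<in> coboundaries p X"
    by (auto simp: coboundaries_def coboundary_linear image_iff split: nat.split
        intro!: exI[of _ "\<lambda>f. 0"])
  show "(\<lambda>f. u f + v f) \<in> coboundaries p X" if uv: "u \<in> coboundaries p X" "v \<in> coboundaries p X"
  proof (cases p)
    case (Suc q)
    then obtain u' v' where "u' \<in> carrier (cochain_module q X)" "v' \<in> carrier (cochain_module q X)"
      "u = coboundary q X u'" "v = coboundary q X v'"
      using uv by (auto simp: coboundaries_def)
    then show ?thesis
      using Suc coboundary_linear(1)[of q X u' v', symmetric]
      by (auto simp: coboundaries_def intro!: rev_image_eqI[of "\<lambda>f. u' f + v' f"])
  qed (use uv in \<open>auto simp: coboundaries_def\<close>)
  show "(\<lambda>f. a * u f) \<in> coboundaries p X" if u: "u \<in> coboundaries p X"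
  proof (cases p)
    case (Suc q)
    then obtain u' where "u' \<in> carrier (cochain_module q X)" "u = coboundary q X u'"
      using u by (auto simp: coboundaries_def)
    then show ?thesis
      using Suc coboundary_linear(2)[of q X a u', symmetric]
      by (auto simp: coboundaries_def intro!: rev_image_eqI[of "\<lambda>f. a * u' f"])
  qed (use u in \<open>auto simp: coboundaries_def\<close>)
qed

text \<open>The normal form to which the coset operations of \<open>subquotient_module\<close> are
  rewritten below.\<close>

definition cohomology_class ::
    "nat \<Rightarrow> 'a topology \<Rightarrow> ('a sing_simplex \<Rightarrow> 'r::comm_ring_1) \<Rightarrow> ('a sing_simplex \<Rightarrow> 'r) set" where
  "cohomology_class p X u = {\<lambda>f. b f + u f | b. b \<in> coboundaries p X}"

lemma r_coset_cohomology_class: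
  "coboundaries p X +>\<^bsub>cochain_module p X\<^esub> u = cohomology_class p X u"
  by (auto simp: a_r_coset_def' cohomology_class_def)

lemma cohomology_class_self: "u \<in> cohomology_class p X u"
  using coboundaries_closed(1)[of p X] by (force simp: cohomology_class_def)

lemma cohomology_class_add_coboundary:
  assumes b: "b \<in> coboundaries p X"
  shows "cohomology_class p X (\<lambda>f. b f + u f) = cohomology_class p X u"
proof
  show "cohomology_class p X (\<lambda>f. b f + u f) \<subseteq> cohomology_class p X u"
  proof
    fix v assume "v \<in> cohomology_class p X (\<lambda>f. b f + u f)"
    then obtain b' where b': "b' \<in> coboundaries p X" "v = (\<lambda>f. b' f + (b f + u f))"
      by (auto simp: cohomology_class_def)
    then show "v \<in> cohomology_class p X u"
      using coboundaries_closed(2)[OF b'(1) b]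
      by (auto simp: cohomology_class_def add.assoc intro!: exI[of _ "\<lambda>f. b' f + b f"])
  qed
  show "cohomology_class p X u \<subseteq> cohomology_class p X (\<lambda>f. b f + u f)"
  proof
    fix v assume "v \<in> cohomology_class p X u"
    then obtain b' where b': "b' \<in> coboundaries p X" "v = (\<lambda>f. b' f + u f)"
      by (auto simp: cohomology_class_def)
    have "(\<lambda>f. b' f + (-1) * b f) \<in> coboundaries p X"
      using b b'(1) by (intro coboundaries_closed)
    then show "v \<in> cohomology_class p X (\<lambda>f. b f + u f)"
      using b'(2)
      by (auto simp: cohomology_class_def fun_eq_iff intro!: exI[of _ "\<lambda>f. b' f + (-1) * b f"])
  qed
qed

lemma cohomology_class_zero: "cohomology_class p X (\<lambda>f. 0) = coboundaries p X"
  by (auto simp: cohomology_class_def)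

lemma cohomology_class_eq_zeroD:
  "cohomology_class p X u = coboundaries p X \<Longrightarrow> u \<in> coboundaries p X"
  using cohomology_class_self by blast

lemma singular_cohomology_simps:
  "carrier (singular_cohomology p X) = cohomology_class p X ` cocycles p X"
  "\<zero>\<^bsub>singular_cohomology p X\<^esub> = coboundaries p X"
  by (simp_all add: singular_cohomology_def subquotient_module_def r_coset_cohomology_class)

lemma singular_cohomology_add:
  "cohomology_class p X u \<oplus>\<^bsub>singular_cohomology p X\<^esub> cohomology_class p X v =
    cohomology_class p X (\<lambda>f. u f + v f)"
proof -
  have "cohomology_class p X u \<oplus>\<^bsub>singular_cohomology p X\<^esub> cohomology_class p X v =
    {\<lambda>f. a f + b f | a b. a \<in> cohomology_class p X u \<and> b \<in> cohomology_class p X v}"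
    by (auto simp: singular_cohomology_def subquotient_module_def set_add_def')
  also have "\<dots> = cohomology_class p X (\<lambda>f. u f + v f)"
  proof (intro equalityI subsetI)
    fix w assume "w \<in> {\<lambda>f. a f + b f | a b. a \<in> cohomology_class p X u \<and> b \<in> cohomology_class p X v}"
    then obtain a b where ab: "a \<in> coboundaries p X" "b \<in> coboundaries p X"
      "w = (\<lambda>f. a f + u f + (b f + v f))"
      unfolding cohomology_class_def by blast
    then have "w = (\<lambda>f. (a f + b f) + (u f + v f))"
      by (simp add: algebra_simps)
    then show "w \<in> cohomology_class p X (\<lambda>f. u f + v f)"
      using coboundaries_closed(2)[OF ab(1,2)] unfolding cohomology_class_def
      by (intro CollectI exI[of _ "\<lambda>f. a f + b f"] conjI)
  next
    fix w assume "w \<in> cohomology_class p X (\<lambda>f. u f + v f)"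
    then obtain a where a: "a \<in> coboundaries p X" "w = (\<lambda>f. a f + (u f + v f))"
      unfolding cohomology_class_def by blast
    then have "w = (\<lambda>f. (a f + u f) + v f)"
      by (simp add: algebra_simps)
    moreover have "(\<lambda>f. a f + u f) \<in> cohomology_class p X u"
      using a(1) unfolding cohomology_class_def by blast
    ultimately show "w \<in> {\<lambda>f. a f + b f | a b. a \<in> cohomology_class p X u \<and> b \<in> cohomology_class p X v}"
      using cohomology_class_self[of v p X] by (intro CollectI exI[of _ "\<lambda>f. a f + u f"] exI[of _ v] conjI)
  qed
  finally show ?thesis .
qed

text \<open>\<open>smult\<close> of the subquotient is a union over all representatives. They all
  contribute the same coset, since coboundaries are closed under scaling.\<close>

lemma singular_cohomology_smult:
  "a \<odot>\<^bsub>singular_cohomology p X\<^esub> cohomology_class p X u = cohomology_class p X (\<lambda>f. a * u f)"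
proof -
  have "cohomology_class p X (\<lambda>f. a * z f) = cohomology_class p X (\<lambda>f. a * u f)"
    if "z \<in> cohomology_class p X u" for z
  proof -
    obtain b where "b \<in> coboundaries p X" "z = (\<lambda>f. b f + u f)"
      using \<open>z \<in> cohomology_class p X u\<close> unfolding cohomology_class_def by blast
    then show ?thesis
      using cohomology_class_add_coboundary[OF coboundaries_closed(3), of b p X a "\<lambda>f. a * u f"]
      by (simp add: distrib_left)
  qed
  then have "(\<Union>z\<in>cohomology_class p X u. cohomology_class p X (\<lambda>f. a * z f)) =
      cohomology_class p X (\<lambda>f. a * u f)"
    using cohomology_class_self[of u p X] by blast
  then show ?thesis
    by (simp add: singular_cohomology_def subquotient_module_def r_coset_cohomology_class)
qed

text \<open>This much structure lets \<open>finsum\<close> be computed by induction.\<close>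

lemma abelian_monoid_singular_cohomology: "abelian_monoid (singular_cohomology p X)"
proof (rule abelian_monoidI)
  show "\<zero>\<^bsub>singular_cohomology p X\<^esub> \<in> carrier (singular_cohomology p X)"
    using cocycles_closed(1)[of p X] cohomology_class_zero[of p X]
    by (auto simp: singular_cohomology_simps image_iff intro!: bexI[of _ "\<lambda>f. 0"])
  show "\<zero>\<^bsub>singular_cohomology p X\<^esub> \<oplus>\<^bsub>singular_cohomology p X\<^esub> A = A"
    if "A \<in> carrier (singular_cohomology p X)" for A :: "('a sing_simplex \<Rightarrow> 'b) set"
    using that by (auto simp: singular_cohomology_simps singular_cohomology_add
        simp flip: cohomology_class_zero)
qed (auto simp: singular_cohomology_simps singular_cohomology_add algebra_simps
       intro!: imageI cocycles_closed)

lemma singular_cohomology_finsum: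
  fixes u :: "'i \<Rightarrow> 'a sing_simplex \<Rightarrow> 'r::comm_ring_1"
  assumes "finite J" and "\<And>i. i \<in> J \<Longrightarrow> u i \<in> cocycles p X"
  shows "(\<Oplus>\<^bsub>singular_cohomology p X\<^esub>i\<in>J. c i \<odot>\<^bsub>singular_cohomology p X\<^esub> cohomology_class p X (u i))
    = cohomology_class p X (\<lambda>f. \<Sum>i\<in>J. c i * u i f)"
  using assms
proof (induction J rule: finite_induct)
  case empty
  interpret abelian_monoid "singular_cohomology p X :: ('r, ('a sing_simplex \<Rightarrow> 'r) set) module"
    by (rule abelian_monoid_singular_cohomology)
  show ?case
    by (simp add: cohomology_class_zero singular_cohomology_simps)
next
  case (insert j J)
  interpret abelian_monoid "singular_cohomology p X :: ('r, ('a sing_simplex \<Rightarrow> 'r) set) module"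
    by (rule abelian_monoid_singular_cohomology)
  have "c i \<odot>\<^bsub>singular_cohomology p X\<^esub> cohomology_class p X (u i) \<in> carrier (singular_cohomology p X)"
    if "i \<in> insert j J" for i
    using insert.prems[OF that]
    by (auto simp: singular_cohomology_smult singular_cohomology_simps intro!: imageI cocycles_closed)
  then show ?case
    using insert
    by (subst finsum_insert) (auto simp: singular_cohomology_smult singular_cohomology_add)
qed

section \<open>Cohomology classes counting crossings\<close>

lemma local_primitive_cong:
  assumes "\<And>x y. x \<in> D \<Longrightarrow> y \<in> D \<Longrightarrow> c x y = c' x y"
  shows "local_primitive D c F \<longleftrightarrow> local_primitive D c' F"
  using assms by (simp add: local_primitive_def)

text \<open>Needed when a primitive is shifted by a constant \<open>a\<close>: the cocycle twisted
  by it changes by \<open>a\<close> times the other cocycle.\<close>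

lemma local_primitive_rescale:
  fixes F G :: "'b::metric_space \<Rightarrow> 'r::comm_ring_1"
  assumes F: "local_primitive D c F" and G: "local_primitive D c' G"
  shows "local_primitive D (\<lambda>x y. c x y - a * c' x y) (\<lambda>x. F x - a * G x)"
  unfolding local_primitive_def
proof
  fix x assume x: "x \<in> D"
  obtain d where d: "d > 0" "\<And>p q. p \<in> D \<inter> ball x d \<Longrightarrow> q \<in> D \<inter> ball x d \<Longrightarrow> F q - F p = c p q"
    using F x unfolding local_primitive_def by blast
  obtain e where e: "e > 0" "\<And>p q. p \<in> D \<inter> ball x e \<Longrightarrow> q \<in> D \<inter> ball x e \<Longrightarrow> G q - G p = c' p q"
    using G x unfolding local_primitive_def by blast
  have "(F q - a * G q) - (F p - a * G p) = c p q - a * c' p q"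
    if "p \<in> D \<inter> ball x (min d e)" "q \<in> D \<inter> ball x (min d e)" for p q
  proof -
    have "F q - F p = c p q" "G q - G p = c' p q"
      using that by (auto intro: d(2) e(2))
    then show ?thesis
      by (simp flip: \<open>F q - F p = c p q\<close> \<open>G q - G p = c' p q\<close> add: algebra_simps)
  qed
  then show "\<exists>d>0. \<forall>p\<in>D \<inter> ball x d. \<forall>q\<in>D \<inter> ball x d.
      (F q - a * G q) - (F p - a * G p) = c p q - a * c' p q"
    using d(1) e(1) by (intro exI[of _ "min d e"]) simp
qed

text \<open>
  \<open>c i\<close> counts the signed crossings of the \<open>i\<close>-th hypersurface between two points that lie in a common
  set of the cover \<open>\<V>\<close>; \<open>s i\<close> is the indicator of one side of that hypersurface.
\<close>

locale jump_system =
  fixes X :: "'a topology" and \<V> :: "'a set set" and I :: "'i set"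
    and s :: "'i \<Rightarrow> 'a \<Rightarrow> 'r::comm_ring_1" and c :: "'i \<Rightarrow> 'a \<Rightarrow> 'a \<Rightarrow> 'r"
  assumes open_cover: "\<And>V. V \<in> \<V> \<Longrightarrow> openin X V" "topspace X \<subseteq> \<Union>\<V>"
    and jump_trans: "\<And>V i p q t. V \<in> \<V> \<Longrightarrow> i \<in> I \<Longrightarrow> p \<in> V \<Longrightarrow> q \<in> V \<Longrightarrow> t \<in> V
      \<Longrightarrow> c i p q + c i q t = c i p t"
    and jump_side: "\<And>V i j p q t. V \<in> \<V> \<Longrightarrow> i \<in> I \<Longrightarrow> j \<in> I \<Longrightarrow> p \<in> V \<Longrightarrow> q \<in> V \<Longrightarrow> t \<in> V
      \<Longrightarrow> c i p q * c j q t = (s i q - s i p) * c j q t"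
begin

abbreviation jump where "jump i \<gamma> \<equiv> (\<lambda>x y. c i (\<gamma> x) (\<gamma> y))"

abbreviation twisted_jump where
  "twisted_jump i j F \<gamma> \<equiv> (\<lambda>x y. (F x - s i (\<gamma> x)) * c j (\<gamma> x) (\<gamma> y))"

lemma cover_ball:
  fixes \<tau> :: "'b::metric_space \<Rightarrow> 'a"
  assumes \<tau>: "continuous_map (top_of_set D) X \<tau>" and x: "x \<in> D"
  obtains V d where "V \<in> \<V>" "d > 0" "\<And>y. y \<in> D \<inter> ball x d \<Longrightarrow> \<tau> y \<in> V"
proof -
  have "\<tau> x \<in> topspace X"
    using continuous_map_image_subset_topspace[OF \<tau>] x by auto
  then obtain V where V: "V \<in> \<V>" "\<tau> x \<in> V"
    using open_cover(2) by blast
  then have "openin (top_of_set D) {y \<in> D. \<tau> y \<in> V}"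
    using openin_continuous_map_preimage[OF \<tau> open_cover(1)] by simp
  then obtain d where "d > 0" "ball x d \<inter> D \<subseteq> {y \<in> D. \<tau> y \<in> V}"
    using x V(2) unfolding openin_contains_ball by blast
  then show ?thesis
    using V(1) by (intro that[of V d]) auto
qed

lemma jump_cocycle:
  assumes "continuous_map (top_of_set D) X \<tau>" "i \<in> I"
  shows "local_cocycle D (jump i \<tau>)"
  unfolding local_cocycle_def
proof
  fix x assume "x \<in> D"
  then obtain V d where V: "V \<in> \<V>" "d > 0" "\<And>y. y \<in> D \<inter> ball x d \<Longrightarrow> \<tau> y \<in> V"
    using cover_ball[OF assms(1)] by blast
  then have "c i (\<tau> p) (\<tau> q) + c i (\<tau> q) (\<tau> t) = c i (\<tau> p) (\<tau> t)"
    if "p \<in> D \<inter> ball x d" "q \<in> D \<inter> ball x d" "t \<in> D \<inter> ball x d" for p q t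
    using that \<open>i \<in> I\<close> by (intro jump_trans[of V]) auto
  then show "\<exists>d>0. \<forall>p\<in>D \<inter> ball x d. \<forall>q\<in>D \<inter> ball x d. \<forall>t\<in>D \<inter> ball x d.
      c i (\<tau> p) (\<tau> q) + c i (\<tau> q) (\<tau> t) = c i (\<tau> p) (\<tau> t)"
    using V(2) by blast
qed

text \<open>
  Together \<open>c i\<close>, \<open>c j\<close> and the twisted cocycle make up a cocycle with values in a Heisenberg group; a
  primitive of the third entry cobounds the cup product of the first two. For \<open>i = j\<close> the
  subtraction of \<open>s i\<close> corrects the term \<open>c i p q * c i q t\<close>, which may be nonzero locally.
\<close>

lemma twisted_jump_cocycle:
  assumes \<tau>: "continuous_map (top_of_set D) X \<tau>" and "i \<in> I" "j \<in> I"
    and F: "local_primitive D (jump i \<tau>) F"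
  shows "local_cocycle D (twisted_jump i j F \<tau>)"
  unfolding local_cocycle_def
proof
  fix x assume x: "x \<in> D"
  then obtain V d where V: "V \<in> \<V>" "d > 0" "\<And>y. y \<in> D \<inter> ball x d \<Longrightarrow> \<tau> y \<in> V"
    using cover_ball[OF \<tau>] by blast
  obtain e where e: "e > 0" and
    Fe: "\<And>p q. p \<in> D \<inter> ball x e \<Longrightarrow> q \<in> D \<inter> ball x e \<Longrightarrow> F q - F p = c i (\<tau> p) (\<tau> q)"
    using F x unfolding local_primitive_def by blast
  have "(F p - s i (\<tau> p)) * c j (\<tau> p) (\<tau> q) + (F q - s i (\<tau> q)) * c j (\<tau> q) (\<tau> t) =
      (F p - s i (\<tau> p)) * c j (\<tau> p) (\<tau> t)"
    if "p \<in> D \<inter> ball x (min d e)" "q \<in> D \<inter> ball x (min d e)" "t \<in> D \<inter> ball x (min d e)" for p q t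
  proof -
    have inV: "\<tau> p \<in> V" "\<tau> q \<in> V" "\<tau> t \<in> V"
      using that by (auto intro: V(3))
    have 1: "c j (\<tau> p) (\<tau> t) = c j (\<tau> p) (\<tau> q) + c j (\<tau> q) (\<tau> t)"
      using jump_trans[OF V(1) \<open>j \<in> I\<close> inV] by simp
    \<comment> \<open>The defect of additivity is \<open>(F q - s i q) - (F p - s i p)\<close> times
      a jump of \<open>j\<close>, with \<open>s i\<close> taken along \<tau>. Since
      \<open>F q - F p\<close> is the jump of \<open>i\<close>, \<open>jump_side\<close> is exactly
      the vanishing of this defect.\<close>
    have "(F q - F p) * c j (\<tau> q) (\<tau> t) = (s i (\<tau> q) - s i (\<tau> p)) * c j (\<tau> q) (\<tau> t)"
      using jump_side[OF V(1) \<open>i \<in> I\<close> \<open>j \<in> I\<close> inV] Fe[of p q] that by simp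
    then show ?thesis
      unfolding 1 by (simp add: algebra_simps)
  qed
  then show "\<exists>d>0. \<forall>p\<in>D \<inter> ball x d. \<forall>q\<in>D \<inter> ball x d. \<forall>t\<in>D \<inter> ball x d.
      (F p - s i (\<tau> p)) * c j (\<tau> p) (\<tau> q) + (F q - s i (\<tau> q)) * c j (\<tau> q) (\<tau> t) =
      (F p - s i (\<tau> p)) * c j (\<tau> p) (\<tau> t)"
    using V(2) e by (intro exI[of _ "min d e"]) simp
qed

text \<open>Any primitive will do: two of them differ by a constant, which cancels in
  \<open>crossing\<close> and is corrected for in \<open>iterated_crossing\<close>.\<close>

definition path_primitive :: "'i \<Rightarrow> (real \<Rightarrow> 'a) \<Rightarrow> real \<Rightarrow> 'r" where
  "path_primitive i \<gamma> = (SOME F. local_primitive {0..1} (jump i \<gamma>) F)"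

definition crossing :: "'i \<Rightarrow> (real \<Rightarrow> 'a) \<Rightarrow> 'r" where
  "crossing i \<gamma> = path_primitive i \<gamma> 1 - path_primitive i \<gamma> 0"

text \<open>
  The last term is the effect of normalising the primitive of \<open>c i\<close> to vanish at the start of the path.
\<close>

definition iterated_crossing :: "'i \<Rightarrow> 'i \<Rightarrow> (real \<Rightarrow> 'a) \<Rightarrow> 'r" where
  "iterated_crossing i j \<gamma> =
     (let G = SOME G. local_primitive {0..1} (twisted_jump i j (path_primitive i \<gamma>) \<gamma>) G
      in G 1 - G 0 - path_primitive i \<gamma> 0 * crossing j \<gamma>)"

lemma path_primitive:
  "local_primitive {0..1} (jump i \<gamma>) F \<Longrightarrow> local_primitive {0..1} (jump i \<gamma>) (path_primitive i \<gamma>)"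
  using someI[of "local_primitive {0..1} (jump i \<gamma>)" F] by (simp add: path_primitive_def)

lemma crossing_eq:
  assumes "local_primitive {0..1} (jump i \<gamma>) F"
  shows "crossing i \<gamma> = F 1 - F 0"
  unfolding crossing_def
  by (rule local_primitive_unique[OF _ path_primitive[OF assms] assms]) auto

text \<open>Replacing the chosen primitive by \<open>Fi\<close> adds the constant
  \<open>Fi 0 - P 0\<close> to the twisting factor and the same multiple of \<open>Fj\<close> to the
  primitive \<open>G\<close>. The correction term absorbs this change, so arbitrary primitives may
  be inserted.\<close>

lemma iterated_crossing_eq:
  assumes Fi: "local_primitive {0..1} (jump i \<gamma>) Fi" and Fj: "local_primitive {0..1} (jump j \<gamma>) Fj"
    and G: "local_primitive {0..1} (twisted_jump i j Fi \<gamma>) G"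
  shows "iterated_crossing i j \<gamma> = G 1 - G 0 - Fi 0 * (Fj 1 - Fj 0)"
proof -
  define P where "P = path_primitive i \<gamma>"
  define G' where "G' = (SOME G. local_primitive {0..1} (twisted_jump i j P \<gamma>) G)"
  have P: "local_primitive {0..1} (jump i \<gamma>) P"
    unfolding P_def by (rule path_primitive[OF Fi])
  have shift: "P x = Fi x - (Fi 0 - P 0)" if "x \<in> {0..1}" for x
  proof -
    have "P x - P 0 = Fi x - Fi 0"
      by (rule local_primitive_unique[OF _ P Fi]) (use that in auto)
    then show ?thesis
      by (metis diff_add_cancel diff_diff_eq2 add.commute)
  qed
  have "local_primitive {0..1} (\<lambda>x y. twisted_jump i j Fi \<gamma> x y - (Fi 0 - P 0) * jump j \<gamma> x y)
      (\<lambda>x. G x - (Fi 0 - P 0) * Fj x)"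
    by (rule local_primitive_rescale[OF G Fj])
  then have *: "local_primitive {0..1} (twisted_jump i j P \<gamma>) (\<lambda>x. G x - (Fi 0 - P 0) * Fj x)"
  proof (rule local_primitive_cong[THEN iffD1, rotated])
    fix x y :: real assume "x \<in> {0..1}"
    then show "twisted_jump i j Fi \<gamma> x y - (Fi 0 - P 0) * jump j \<gamma> x y = twisted_jump i j P \<gamma> x y"
      unfolding shift[OF \<open>x \<in> {0..1}\<close>] by (simp only: left_diff_distrib) (simp add: algebra_simps)
  qed
  then have "local_primitive {0..1} (twisted_jump i j P \<gamma>) G'"
    using someI[of "local_primitive {0..1} (twisted_jump i j P \<gamma>)"] by (simp add: G'_def)
  then have "G' 1 - G' 0 = (G 1 - (Fi 0 - P 0) * Fj 1) - (G 0 - (Fi 0 - P 0) * Fj 0)"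
    using * by (intro local_primitive_unique[of "{0..1}"]) auto
  then show ?thesis
    by (simp add: iterated_crossing_def crossing_eq[OF Fj] flip: P_def G'_def)
      (simp add: algebra_simps)
qed

end

section \<open>Edges and vertices of singular 2-simplices\<close>

declare One_nat_def [simp del]

definition edge_point :: "real \<Rightarrow> nat \<Rightarrow> real" where
  "edge_point t = (\<lambda>i. if i = 0 then 1 - t else if i = 1 then t else 0)"

text \<open>\<open>local_primitive_exists\<close> works in a normed space, so the 2-simplex is
  parametrised by a plane triangle whose corners \<open>(0, 0)\<close>, \<open>(1, 0)\<close>,
  \<open>(0, 1)\<close> are the vertices 0, 1, 2.\<close>

definition triangle_point :: "real \<times> real \<Rightarrow> nat \<Rightarrow> real" where
  "triangle_point z = (\<lambda>i. if i = 0 then 1 - fst z - snd z else if i = 1 then fst z else if i = 2 then snd z else 0)"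

definition triangle :: "(real \<times> real) set" where
  "triangle = {z. 0 \<le> fst z \<and> 0 \<le> snd z \<and> fst z + snd z \<le> 1}"

definition simplex_path :: "'a sing_simplex \<Rightarrow> real \<Rightarrow> 'a" where
  "simplex_path f t = f (edge_point t)"

lemma convex_triangle: "convex triangle"
  unfolding triangle_def
proof (rule convexI, clarsimp)
  fix a b a' b' u v :: real
  assume *: "0 \<le> a" "0 \<le> b" "a + b \<le> 1" "0 \<le> a'" "0 \<le> b'" "a' + b' \<le> 1" "0 \<le> u" "0 \<le> v" "u + v = 1"
  have "u * (a + b) + v * (a' + b') \<le> u * 1 + v * 1"
    using * by (intro add_mono mult_left_mono) auto
  then show "u * a + v * a' + (u * b + v * b') \<le> 1"
    using * by (simp add: algebra_simps)
qed

lemma compact_triangle: "compact triangle"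
proof -
  have "closed triangle"
    unfolding triangle_def
    by (intro closed_Collect_conj closed_Collect_le continuous_intros)
  moreover have "triangle \<subseteq> {0..1} \<times> {0..1}"
    by (auto simp: triangle_def)
  ultimately show ?thesis
    by (metis compact_Icc compact_Int_closed compact_Times inf.absorb2)
qed

lemma edge_point_in_simplex: "t \<in> {0..1} \<Longrightarrow> edge_point t \<in> standard_simplex 1"
  by (auto simp: standard_simplex_def edge_point_def One_nat_def)

lemma triangle_point_in_simplex: "z \<in> triangle \<Longrightarrow> triangle_point z \<in> standard_simplex 2"
  by (auto simp: standard_simplex_def triangle_point_def triangle_def numeral_2_eq_2)

lemma continuous_on_triangle_point: "continuous_on D (\<lambda>z. triangle_point z i)"
  by (cases "i = 0"; cases "i = 1"; cases "i = 2") (auto simp: triangle_point_def intro!: continuous_intros)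

lemma continuous_map_triangle:
  assumes "singular_simplex 2 X f"
  shows "continuous_map (top_of_set triangle) X (\<lambda>z. f (triangle_point z))"
proof -
  have "continuous_map (top_of_set triangle) (subtopology (powertop_real UNIV) (standard_simplex 2)) triangle_point"
    by (auto simp: continuous_map_in_subtopology continuous_map_componentwise_UNIV triangle_point_in_simplex
        continuous_on_triangle_point)
  then have "continuous_map (top_of_set triangle) X (f \<circ> triangle_point)"
    using assms continuous_map_compose unfolding singular_simplex_def by blast
  then show ?thesis
    by (simp add: o_def)
qed

text \<open>Faces 2, 1, 0 omit the vertex of that number; they are the edges 01, 02, 12, each run
  from the lower to the higher vertex.\<close>

lemma simplex_path_face:
  assumes "t \<in> {0..1}"
  shows "simplex_path (singular_face 2 2 f) t = f (triangle_point (t, 0))"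
    and "simplex_path (singular_face 2 1 f) t = f (triangle_point (0, t))"
    and "simplex_path (singular_face 2 0 f) t = f (triangle_point (1 - t, t))"
proof -
  have "simplical_face 2 (edge_point t) = triangle_point (t, 0)"
    by (auto simp: simplical_face_def edge_point_def triangle_point_def fun_eq_iff)
  moreover have "simplical_face 1 (edge_point t) = triangle_point (0, t)"
    by (auto simp: simplical_face_def edge_point_def triangle_point_def fun_eq_iff)
  moreover have "simplical_face 0 (edge_point t) = triangle_point (1 - t, t)"
    by (auto simp: simplical_face_def edge_point_def triangle_point_def fun_eq_iff)
  ultimately show "simplex_path (singular_face 2 2 f) t = f (triangle_point (t, 0))"
    "simplex_path (singular_face 2 1 f) t = f (triangle_point (0, t))"
    "simplex_path (singular_face 2 0 f) t = f (triangle_point (1 - t, t))"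
    using edge_point_in_simplex[OF assms] by (simp_all add: simplex_path_def singular_face_def)
qed

text \<open>The front face omits vertex 2. On the 1-simplex all coordinates from 2 on vanish, so
  inserting a zero in position 2 changes nothing.\<close>

lemma front_face_eq_singular_face: "front_face 1 f = singular_face 2 2 f"
proof -
  have "simplical_face 2 x = x" if "x \<in> standard_simplex 1" for x :: "nat \<Rightarrow> real"
    using that by (auto simp: simplical_face_def standard_simplex_def fun_eq_iff)
  then show ?thesis
    unfolding front_face_def singular_face_def by (intro ext) (auto simp: restrict_def One_nat_def)
qed

lemma back_face_eq_singular_face: "back_face 1 1 f = singular_face 2 0 f"
proof -
  have "simplical_face 0 x = (\<lambda>i. if i < 1 then 0 else x (i - 1))" for x :: "nat \<Rightarrow> real"
    by (auto simp: simplical_face_def fun_eq_iff)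
  then show ?thesis
    unfolding back_face_def singular_face_def by (intro ext) (auto simp: restrict_def One_nat_def)
qed

lemma coboundary_0:
  "coboundary 0 X u f =
    (if singular_simplex 1 X f then u (singular_face 1 0 f) - u (singular_face 1 1 f) else 0)"
  by (simp add: coboundary_def One_nat_def)

lemma coboundary_1:
  "coboundary 1 X u f =
    (if singular_simplex 2 X f
     then u (singular_face 2 0 f) - u (singular_face 2 1 f) + u (singular_face 2 2 f) else 0)"
  by (simp add: coboundary_def numeral_2_eq_2 One_nat_def)

lemma coboundaries_1_2:
  "coboundaries 1 X = coboundary 0 X ` carrier (cochain_module 0 X)"
  "coboundaries 2 X = coboundary 1 X ` carrier (cochain_module 1 X)"
  by (simp_all add: coboundaries_def One_nat_def numeral_2_eq_2)

text \<open>
  The bookkeeping for \<open>(\<delta>a + x) \<smile> (\<delta>b + y) = \<delta> (a \<smile> (\<delta>b + y) - x \<smile> b - w)\<close> on a 2-simplex, where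
  \<open>\<delta>w = - (x \<smile> y)\<close>; indices denote vertices and edges.
\<close>

lemma cup_primitive_identity:
  fixes a0 :: "'r::comm_ring_1"
  assumes "w12 - w02 + w01 = - (x01 * y12)"
  shows "((a1 - a0) + x01) * ((b2 - b1) + y12) =
    (a1 * ((b2 - b1) + y12) - x12 * b2 - w12)
    - (a0 * ((b2 - b0) + (y01 + y12)) - (x01 + x12) * b2 - w02)
    + (a0 * ((b1 - b0) + y01) - x01 * b1 - w01)"
proof -
  have "w12 = w02 - w01 - x01 * y12"
    using assms by (simp add: algebra_simps)
  then show ?thesis
    by (simp add: algebra_simps)
qed

lemma singular_face_singular_face_2:
  assumes "a \<le> 1"
  shows "singular_face 1 a (singular_face 2 b f) =
    restrict (\<lambda>x. f (simplical_face b (simplical_face a x))) (standard_simplex 0)"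
proof
  fix x :: "nat \<Rightarrow> real"
  show "singular_face 1 a (singular_face 2 b f) x =
    restrict (\<lambda>x. f (simplical_face b (simplical_face a x))) (standard_simplex 0) x"
    using simplical_face_in_standard_simplex[of 1 a x] assms
    by (cases "x \<in> standard_simplex 0") (simp_all add: singular_face_def One_nat_def)
qed

text \<open>Each equation is a vertex common to two edges: vertex 0 of 01 and 02, vertex 1 of 01 and
  12, vertex 2 of 02 and 12.\<close>

lemma vertices_of_2_simplex:
  "singular_face 1 1 (singular_face 2 2 f) = singular_face 1 1 (singular_face 2 1 f)"
  "singular_face 1 0 (singular_face 2 2 f) = singular_face 1 1 (singular_face 2 0 f)"
  "singular_face 1 0 (singular_face 2 1 f) = singular_face 1 0 (singular_face 2 0 f)"
proof -
  have "simplical_face 2 (simplical_face 1 x) = simplical_face 1 (simplical_face 1 x)"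
    "simplical_face 2 (simplical_face 0 x) = simplical_face 0 (simplical_face 1 x)"
    "simplical_face 1 (simplical_face 0 x) = simplical_face 0 (simplical_face 0 x)" for x :: "nat \<Rightarrow> real"
    by (auto simp: simplical_face_def fun_eq_iff One_nat_def)
  then show
    "singular_face 1 1 (singular_face 2 2 f) = singular_face 1 1 (singular_face 2 1 f)"
    "singular_face 1 0 (singular_face 2 2 f) = singular_face 1 1 (singular_face 2 0 f)"
    "singular_face 1 0 (singular_face 2 1 f) = singular_face 1 0 (singular_face 2 0 f)"
    by (simp_all add: singular_face_singular_face_2)
qed

lemma singular_simplex_faces:
  assumes "singular_simplex 2 X f" "k \<le> 2"
  shows "singular_simplex 1 X (singular_face 2 k f)"
  using singular_simplex_singular_face[OF assms(1) _ assms(2)] by simp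

context jump_system
begin

text \<open>Paths that agree on the unit interval have the same primitives there, so the predicate
  under \<open>SOME\<close> is the same and even the chosen primitives coincide.\<close>

lemma path_primitive_cong:
  assumes "\<And>t. t \<in> {0..1} \<Longrightarrow> \<gamma> t = \<gamma>' t"
  shows "path_primitive i \<gamma> = path_primitive i \<gamma>'"
proof -
  have "local_primitive {0..1} (jump i \<gamma>) F \<longleftrightarrow> local_primitive {0..1} (jump i \<gamma>') F" for F :: "real \<Rightarrow> 'r"
    by (rule local_primitive_cong) (simp add: assms)
  then show ?thesis
    by (simp add: path_primitive_def)
qed

lemma crossing_cong:
  assumes "\<And>t. t \<in> {0..1} \<Longrightarrow> \<gamma> t = \<gamma>' t"
  shows "crossing i \<gamma> = crossing i \<gamma>'"
  using path_primitive_cong[of \<gamma> \<gamma>' i] assms by (simp add: crossing_def)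

lemma iterated_crossing_cong:
  assumes "\<And>t. t \<in> {0..1} \<Longrightarrow> \<gamma> t = \<gamma>' t"
  shows "iterated_crossing i j \<gamma> = iterated_crossing i j \<gamma>'"
proof -
  have "local_primitive {0..1} (twisted_jump i j P \<gamma>) F \<longleftrightarrow> local_primitive {0..1} (twisted_jump i j P \<gamma>') F"
    for P F :: "real \<Rightarrow> 'r"
    by (rule local_primitive_cong) (simp add: assms)
  then show ?thesis
    using path_primitive_cong[of \<gamma> \<gamma>' i] crossing_cong[of \<gamma> \<gamma>' j] assms
    by (simp add: iterated_crossing_def)
qed

text \<open>On the whole triangle there are primitives \<open>F\<close>, \<open>H\<close> of the two
  jumps and \<open>G\<close> of the twisted one, and each edge contributes a difference of vertex
  values. The values of \<open>G\<close> cancel around the boundary; what remains is the product of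
  the increment of \<open>F\<close> on edge 01 and that of \<open>H\<close> on edge 12, as for
  iterated integrals.\<close>

lemma triangle_crossing:
  fixes \<tau> :: "real \<times> real \<Rightarrow> 'a"
  assumes \<tau>: "continuous_map (top_of_set triangle) X \<tau>" and "i \<in> I" "j \<in> I"
  shows "crossing i (\<lambda>t. \<tau> (t, 0)) + crossing i (\<lambda>t. \<tau> (1 - t, t)) = crossing i (\<lambda>t. \<tau> (0, t))"
    and "iterated_crossing i j (\<lambda>t. \<tau> (1 - t, t)) - iterated_crossing i j (\<lambda>t. \<tau> (0, t))
      + iterated_crossing i j (\<lambda>t. \<tau> (t, 0))
      = - (crossing i (\<lambda>t. \<tau> (t, 0)) * crossing j (\<lambda>t. \<tau> (1 - t, t)))"
proof -
  have ex: "\<exists>F. local_primitive triangle c F" if "local_cocycle triangle c"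
    for c :: "real \<times> real \<Rightarrow> real \<times> real \<Rightarrow> 'r"
    using local_primitive_exists[OF convex_triangle compact_triangle that] by blast
  obtain F H where F: "local_primitive triangle (jump i \<tau>) F" and H: "local_primitive triangle (jump j \<tau>) H"
    using ex jump_cocycle[OF \<tau>] \<open>i \<in> I\<close> \<open>j \<in> I\<close> by metis
  obtain G where G: "local_primitive triangle (twisted_jump i j F \<tau>) G"
    using ex twisted_jump_cocycle[OF \<tau> \<open>i \<in> I\<close> \<open>j \<in> I\<close> F] by blast
  have edge: "crossing i (\<lambda>t. \<tau> (g t)) = F (g 1) - F (g 0)"
      "crossing j (\<lambda>t. \<tau> (g t)) = H (g 1) - H (g 0)"
      "iterated_crossing i j (\<lambda>t. \<tau> (g t)) = G (g 1) - G (g 0) - F (g 0) * (H (g 1) - H (g 0))"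
    if g: "continuous_on {0..1} g" "g \<in> {0..1} \<rightarrow> triangle" for g
    using crossing_eq[OF local_primitive_compose[OF F g]] crossing_eq[OF local_primitive_compose[OF H g]]
      iterated_crossing_eq[OF local_primitive_compose[OF F g] local_primitive_compose[OF H g]
        local_primitive_compose[OF G g]] by simp_all
  have [simp]: "(\<lambda>t. (t, 0)) \<in> {0..1} \<rightarrow> triangle" "(\<lambda>t. (0, t)) \<in> {0..1} \<rightarrow> triangle"
    "(\<lambda>t. (1 - t, t)) \<in> {0..1} \<rightarrow> triangle"
    by (auto simp: triangle_def)
  have [simp]: "continuous_on {0..1} (\<lambda>t::real. (t, 0::real))" "continuous_on {0..1} (\<lambda>t::real. (0::real, t))"
    "continuous_on {0..1} (\<lambda>t::real. (1 - t, t))"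
    by (intro continuous_intros)+
  have e01: "crossing i (\<lambda>t. \<tau> (t, 0)) = F (1, 0) - F (0, 0)"
      "iterated_crossing i j (\<lambda>t. \<tau> (t, 0)) = G (1, 0) - G (0, 0) - F (0, 0) * (H (1, 0) - H (0, 0))"
    using edge[of "\<lambda>t. (t, 0)"] by simp_all
  have e02: "crossing i (\<lambda>t. \<tau> (0, t)) = F (0, 1) - F (0, 0)"
      "iterated_crossing i j (\<lambda>t. \<tau> (0, t)) = G (0, 1) - G (0, 0) - F (0, 0) * (H (0, 1) - H (0, 0))"
    using edge[of "\<lambda>t. (0, t)"] by simp_all
  have e12: "crossing i (\<lambda>t. \<tau> (1 - t, t)) = F (0, 1) - F (1, 0)"
      "crossing j (\<lambda>t. \<tau> (1 - t, t)) = H (0, 1) - H (1, 0)"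
      "iterated_crossing i j (\<lambda>t. \<tau> (1 - t, t)) = G (0, 1) - G (1, 0) - F (1, 0) * (H (0, 1) - H (1, 0))"
    using edge[of "\<lambda>t. (1 - t, t)"] by simp_all
  show "crossing i (\<lambda>t. \<tau> (t, 0)) + crossing i (\<lambda>t. \<tau> (1 - t, t)) = crossing i (\<lambda>t. \<tau> (0, t))"
    unfolding e01 e02 e12 by simp
  show "iterated_crossing i j (\<lambda>t. \<tau> (1 - t, t)) - iterated_crossing i j (\<lambda>t. \<tau> (0, t))
      + iterated_crossing i j (\<lambda>t. \<tau> (t, 0))
      = - (crossing i (\<lambda>t. \<tau> (t, 0)) * crossing j (\<lambda>t. \<tau> (1 - t, t)))"
    unfolding e01 e02 e12 by (simp add: algebra_simps)
qed

definition crossing_cochain :: "'i \<Rightarrow> 'a sing_simplex \<Rightarrow> 'r" where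
  "crossing_cochain i f = (if singular_simplex 1 X f then crossing i (simplex_path f) else 0)"

definition iterated_cochain :: "'i \<Rightarrow> 'i \<Rightarrow> 'a sing_simplex \<Rightarrow> 'r" where
  "iterated_cochain i j f = (if singular_simplex 1 X f then iterated_crossing i j (simplex_path f) else 0)"

lemma crossing_cochain_2_simplex:
  assumes f: "singular_simplex 2 X f" and "i \<in> I" "j \<in> I"
  shows "crossing_cochain i (singular_face 2 2 f) + crossing_cochain i (singular_face 2 0 f)
      = crossing_cochain i (singular_face 2 1 f)"
    and "coboundary 1 X (iterated_cochain i j) f
      = - (crossing_cochain i (singular_face 2 2 f) * crossing_cochain j (singular_face 2 0 f))"
proof -
  have [simp]: "singular_simplex 1 X (singular_face 2 k f)" if "k \<le> 2" for k
    using singular_simplex_faces[OF f that] .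
  have "crossing k (simplex_path (singular_face 2 2 f)) = crossing k (\<lambda>t. f (triangle_point (t, 0)))"
    "crossing k (simplex_path (singular_face 2 1 f)) = crossing k (\<lambda>t. f (triangle_point (0, t)))"
    "crossing k (simplex_path (singular_face 2 0 f)) = crossing k (\<lambda>t. f (triangle_point (1 - t, t)))" for k
    by (rule crossing_cong, rule simplex_path_face, assumption)+
  note [simp] = this
  have [simp]:
    "iterated_crossing i j (simplex_path (singular_face 2 2 f)) = iterated_crossing i j (\<lambda>t. f (triangle_point (t, 0)))"
    "iterated_crossing i j (simplex_path (singular_face 2 1 f)) = iterated_crossing i j (\<lambda>t. f (triangle_point (0, t)))"
    "iterated_crossing i j (simplex_path (singular_face 2 0 f)) = iterated_crossing i j (\<lambda>t. f (triangle_point (1 - t, t)))"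
    by (rule iterated_crossing_cong, rule simplex_path_face, assumption)+
  note tri = triangle_crossing[OF continuous_map_triangle[OF f] \<open>i \<in> I\<close> \<open>j \<in> I\<close>]
  show "crossing_cochain i (singular_face 2 2 f) + crossing_cochain i (singular_face 2 0 f)
      = crossing_cochain i (singular_face 2 1 f)"
    using tri(1) by (simp add: crossing_cochain_def)
  show "coboundary 1 X (iterated_cochain i j) f
      = - (crossing_cochain i (singular_face 2 2 f) * crossing_cochain j (singular_face 2 0 f))"
    using tri(2) f by (simp add: crossing_cochain_def iterated_cochain_def coboundary_1)
qed

lemma crossing_cochain_cocycle:
  assumes "i \<in> I"
  shows "crossing_cochain i \<in> cocycles 1 X"
proof -
  have "coboundary 1 X (crossing_cochain i) f = 0" for f
    using crossing_cochain_2_simplex(1)[of f i i] assms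
    by (auto simp: coboundary_1 algebra_simps)
  then show ?thesis
    by (auto simp: cocycles_def crossing_cochain_def)
qed

text \<open>\<open>cup_product\<close> runs over all representatives, so the primitive has to be
  found for arbitrary cohomologous \<open>u\<close> and \<open>v\<close>. The union then collapses
  to the zero coset.\<close>

lemma cup_crossing_cochain:
  assumes "i \<in> I" "j \<in> I"
  shows "cup_product 1 1 X (cohomology_class 1 X (crossing_cochain i)) (cohomology_class 1 X (crossing_cochain j))
    = \<zero>\<^bsub>singular_cohomology 2 X\<^esub>"
proof -
  have "cochain_cup 1 1 X u v \<in> coboundaries 2 X"
    if u: "u \<in> cohomology_class 1 X (crossing_cochain i)" and v: "v \<in> cohomology_class 1 X (crossing_cochain j)" for u v
  proof -
    obtain a where a: "a \<in> carrier (cochain_module 0 X)" "u = (\<lambda>f. coboundary 0 X a f + crossing_cochain i f)"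
      using u by (auto simp: cohomology_class_def coboundaries_1_2)
    obtain b where b: "b \<in> carrier (cochain_module 0 X)" "v = (\<lambda>f. coboundary 0 X b f + crossing_cochain j f)"
      using v by (auto simp: cohomology_class_def coboundaries_1_2)
    \<comment> \<open>The cochain under \<delta> in \<open>cup_primitive_identity\<close>, evaluated
      on an edge: \<open>a\<close> sits at the start vertex, \<open>b\<close> at the end
      vertex.\<close>
    define w where "w e = (if singular_simplex 1 X e then
      a (singular_face 1 1 e) * v e - crossing_cochain i e * b (singular_face 1 0 e) - iterated_cochain i j e else 0)" for e
    have "cochain_cup 1 1 X u v f = coboundary 1 X w f" for f
    proof (cases "singular_simplex 2 X f")
      case True
      note s = singular_simplex_faces[OF True]
      note rel = crossing_cochain_2_simplex[OF True]
      have j: "crossing_cochain j (singular_face 2 1 f) =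
          crossing_cochain j (singular_face 2 2 f) + crossing_cochain j (singular_face 2 0 f)"
        "crossing_cochain i (singular_face 2 1 f) =
          crossing_cochain i (singular_face 2 2 f) + crossing_cochain i (singular_face 2 0 f)"
        using rel(1) assms by simp_all
      have "coboundary 1 X (iterated_cochain i j) f = iterated_cochain i j (singular_face 2 0 f)
          - iterated_cochain i j (singular_face 2 1 f) + iterated_cochain i j (singular_face 2 2 f)"
        using True by (simp add: coboundary_1)
      note id = cup_primitive_identity[OF trans[OF this[symmetric] rel(2)[OF assms]]]
      have "cochain_cup 1 1 X u v f = u (singular_face 2 2 f) * v (singular_face 2 0 f)"
        using True unfolding cochain_cup_def front_face_eq_singular_face back_face_eq_singular_face
        by simp
      then show ?thesis
        using True unfolding coboundary_1
        by (simp only: s w_def a(2) b(2) coboundary_0 vertices_of_2_simplex j if_True id order_refl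
          zero_le one_le_numeral)
    qed (simp add: coboundary_1 cochain_cup_def)
    moreover have "w \<in> carrier (cochain_module 1 X)"
      by (simp add: w_def)
    ultimately show ?thesis
      unfolding coboundaries_1_2 by (intro image_eqI[of _ _ w]) (auto simp: fun_eq_iff)
  qed
  then have "cohomology_class 2 X (cochain_cup 1 1 X u v) = coboundaries 2 X"
    if "u \<in> cohomology_class 1 X (crossing_cochain i)" "v \<in> cohomology_class 1 X (crossing_cochain j)" for u v
    using cohomology_class_add_coboundary[of "cochain_cup 1 1 X u v" 2 X "\<lambda>f. 0"] that
    by (simp add: cohomology_class_zero)
  then show ?thesis
    using cohomology_class_self[of "crossing_cochain i" 1 X] cohomology_class_self[of "crossing_cochain j" 1 X]
    unfolding cup_product_def singular_cohomology_simps(2) r_coset_cohomology_class one_add_one by auto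
qed

text \<open>A coboundary vanishes on every 1-cycle, and the loop for \<open>i\<close> reads off the
  coefficient of \<open>i\<close>. Two 1-simplices with matching ends already form a cycle, so the
  two paths are never concatenated.\<close>

lemma independent_crossing_cochain:
  assumes loops: "\<And>i. i \<in> I \<Longrightarrow> \<exists>\<gamma> \<delta>.
      continuous_map (top_of_set {0..1}) X \<gamma> \<and> continuous_map (top_of_set {0..1}) X \<delta> \<and>
      \<delta> 0 = \<gamma> 1 \<and> \<delta> 1 = \<gamma> 0 \<and>
      (\<forall>j\<in>I. crossing j \<gamma> + crossing j \<delta> = (if j = i then 1 else 0))"
  shows "module_independent (singular_cohomology 1 X) I (\<lambda>i. cohomology_class 1 X (crossing_cochain i))"
  unfolding module_independent_def
proof (intro conjI allI impI ballI)
  show "(\<lambda>i. cohomology_class 1 X (crossing_cochain i)) \<in> I \<rightarrow> carrier (singular_cohomology 1 X)"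
    unfolding singular_cohomology_simps by (intro funcsetI imageI crossing_cochain_cocycle)
next
  fix k :: "'i \<Rightarrow> 'r" and J i
  assume *: "finite J \<and> J \<subseteq> I \<and>
      (\<Oplus>\<^bsub>singular_cohomology 1 X\<^esub>i\<in>J. k i \<odot>\<^bsub>singular_cohomology 1 X\<^esub> cohomology_class 1 X (crossing_cochain i))
      = \<zero>\<^bsub>singular_cohomology 1 X\<^esub>" and i: "i \<in> J"
  define u where "u f = (\<Sum>j\<in>J. k j * crossing_cochain j f)" for f
  have "crossing_cochain j \<in> cocycles 1 X" if "j \<in> J" for j
    using * that by (intro crossing_cochain_cocycle) blast
  then have "(\<Oplus>\<^bsub>singular_cohomology 1 X\<^esub>i\<in>J. k i \<odot>\<^bsub>singular_cohomology 1 X\<^esub> cohomology_class 1 X (crossing_cochain i))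
      = cohomology_class 1 X (\<lambda>f. \<Sum>j\<in>J. k j * crossing_cochain j f)"
    by (rule singular_cohomology_finsum[OF conjunct1[OF *]])
  then have "cohomology_class 1 X u = coboundaries 1 X"
    using conjunct2[OF conjunct2[OF *]] unfolding u_def[abs_def] singular_cohomology_simps(2)
    by (rule trans[OF sym])
  then have "u \<in> coboundaries 1 X"
    by (rule cohomology_class_eq_zeroD)
  then obtain b where b: "u = coboundary 0 X b"
    unfolding coboundaries_1_2 by blast
  obtain \<gamma> \<delta> where paths: "continuous_map (top_of_set {0..1}) X \<gamma>" "continuous_map (top_of_set {0..1}) X \<delta>"
      and ends: "\<delta> 0 = \<gamma> 1" "\<delta> 1 = \<gamma> 0"
      and cross: "\<And>j. j \<in> I \<Longrightarrow> crossing j \<gamma> + crossing j \<delta> = (if j = i then 1 else 0)"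
    using loops[OF subsetD[OF conjunct1[OF conjunct2[OF *]] i]] by blast
  \<comment> \<open>The coordinate \<open>x 1\<close> recovers \<open>t\<close> from
    \<open>edge_point t\<close>, so \<open>simplex_path\<close> gives back the path on the unit
    interval.\<close>
  define simp where "simp \<rho> = restrict (\<lambda>x. \<rho> (x 1)) (standard_simplex 1)" for \<rho> :: "real \<Rightarrow> 'a"
  have simp: "singular_simplex 1 X (simp \<rho>)" "crossing_cochain j (simp \<rho>) = crossing j \<rho>"
    "b (singular_face 1 0 (simp \<rho>)) = b (restrict (\<lambda>x. \<rho> 1) (standard_simplex 0))"
    "b (singular_face 1 1 (simp \<rho>)) = b (restrict (\<lambda>x. \<rho> 0) (standard_simplex 0))"
    if \<rho>: "continuous_map (top_of_set {0..1}) X \<rho>" for \<rho> j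
  proof -
    have "continuous_map (subtopology (powertop_real UNIV) (standard_simplex 1)) (top_of_set {0..1}) (\<lambda>x. x 1)"
      by (auto simp: continuous_map_in_subtopology standard_simplex_def
          intro!: continuous_map_from_subtopology continuous_map_product_projection)
    then have "continuous_map (subtopology (powertop_real UNIV) (standard_simplex 1)) X (\<rho> \<circ> (\<lambda>x. x 1))"
      using \<rho> continuous_map_compose by blast
    then show s: "singular_simplex 1 X (simp \<rho>)"
      by (simp add: singular_simplex_def simp_def o_def)
    have "simplex_path (simp \<rho>) t = \<rho> t" if "t \<in> {0..1}" for t
      using edge_point_in_simplex[OF that] by (simp add: simplex_path_def simp_def) (simp add: edge_point_def)
    then show "crossing_cochain j (simp \<rho>) = crossing j \<rho>"
      using s crossing_cong[of "simplex_path (simp \<rho>)" \<rho> j] by (simp add: crossing_cochain_def)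
    have x0: "x 0 = 1" if "x \<in> standard_simplex 0" for x
      using that by (simp add: standard_simplex_def)
    have faces: "singular_face 1 0 (simp \<rho>) x = restrict (\<lambda>x. \<rho> 1) (standard_simplex 0) x"
      "singular_face 1 1 (simp \<rho>) x = restrict (\<lambda>x. \<rho> 0) (standard_simplex 0) x" for x
      using simplical_face_in_standard_simplex[of 1 0 x] simplical_face_in_standard_simplex[of 1 1 x] x0[of x]
      by (cases "x \<in> standard_simplex 0";
          simp add: singular_face_def simp_def One_nat_def; simp add: simplical_face_def)+
    show "b (singular_face 1 0 (simp \<rho>)) = b (restrict (\<lambda>x. \<rho> 1) (standard_simplex 0))"
      "b (singular_face 1 1 (simp \<rho>)) = b (restrict (\<lambda>x. \<rho> 0) (standard_simplex 0))"
      by (simp_all only: ext[OF faces(1)] ext[OF faces(2)])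
  qed
  \<comment> \<open>On an edge a coboundary is the difference of the values at the two ends; around
    the closed chain these cancel.\<close>
  have "0 = u (simp \<gamma>) + u (simp \<delta>)"
    unfolding b coboundary_0 using simp[OF paths(1)] simp[OF paths(2)] ends by simp
  also have "\<dots> = (\<Sum>j\<in>J. k j * (crossing j \<gamma> + crossing j \<delta>))"
    by (simp add: u_def simp[OF paths(1)] simp[OF paths(2)] sum.distrib distrib_left)
  also have "\<dots> = (\<Sum>j\<in>J. if j = i then k j else 0)"
    using * cross by (intro sum.cong) auto
  also have "\<dots> = k i"
    using * i by simp
  finally show "k i = 0" by simp
qed

end

declare One_nat_def [simp]

section \<open>Integrals depending on a parameter\<close>

lemma continuous_map_euclideanrealI:
  assumes "\<And>x e. x \<in> topspace X \<Longrightarrow> e > 0 \<Longrightarrow>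
    \<exists>U. openin X U \<and> x \<in> U \<and> (\<forall>y\<in>U. \<bar>f y - f x\<bar> < e)"
  shows "continuous_map X euclideanreal f"
  unfolding continuous_map_def
proof (intro conjI allI impI)
  fix V :: "real set" assume "openin euclideanreal V"
  then have V: "open V" by simp
  show "openin X {x \<in> topspace X. f x \<in> V}"
  proof (subst openin_subopen, intro ballI)
    fix x assume "x \<in> {x \<in> topspace X. f x \<in> V}"
    then have x: "x \<in> topspace X" "f x \<in> V" by auto
    then obtain e where e: "e > 0" "\<And>z. dist z (f x) < e \<Longrightarrow> z \<in> V"
      using V open_dist by metis
    obtain U where U: "openin X U" "x \<in> U" "\<forall>y\<in>U. \<bar>f y - f x\<bar> < e"
      using assms[OF x(1) e(1)] by blast
    then have "U \<subseteq> {x \<in> topspace X. f x \<in> V}"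
      using e(2) openin_subset[OF U(1)] by (auto simp: dist_real_def)
    then show "\<exists>T. openin X T \<and> x \<in> T \<and> T \<subseteq> {x \<in> topspace X. f x \<in> V}"
      using U by blast
  qed
qed simp

lemma has_integral_bounded_support:
  fixes f :: "real \<Rightarrow> real"
  assumes "continuous_on UNIV f" and "\<And>t. \<bar>t\<bar> > T \<Longrightarrow> f t = 0"
  shows "(f has_integral integral {-T..T} f) UNIV"
proof (rule has_integral_on_superset)
  have "f integrable_on {-T..T}"
    using assms(1) by (intro integrable_continuous_real) (auto intro: continuous_on_subset)
  then show "(f has_integral integral {-T..T} f) {-T..T}"
    by (rule integrable_integral)
  show "f t = 0" if "t \<notin> {-T..T}" for t
    using that assms(2)[of t] by auto
qed simp

lemma has_integral_shift_UNIV: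
  fixes f :: "real \<Rightarrow> real"
  assumes f: "continuous_on UNIV f" and supp: "\<And>t. \<bar>t\<bar> > T \<Longrightarrow> f t = 0" and I: "(f has_integral I) UNIV"
  shows "((\<lambda>t. f (t + s)) has_integral I) UNIV"
proof -
  have "I = integral {-T..T} f"
    using has_integral_unique[OF I has_integral_bounded_support[OF f supp]] by simp
  moreover have "f integrable_on {-T..T}"
    using f by (intro integrable_continuous_real) (auto intro: continuous_on_subset)
  ultimately have "(f has_integral I) {-T..T}"
    by (simp add: integrable_integral)
  then have "((\<lambda>t. f (t + s)) has_integral I) {-T - s..T - s}"
    by (rule has_integral_shift_real_ivl)
  then show ?thesis
  proof (rule has_integral_on_superset)
    show "f (t + s) = 0" if "t \<notin> {-T - s..T - s}" for t
      using that supp[of "t + s"] by auto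
  qed simp
qed

text \<open>Near \<open>x\<close> all integrals run over one compact interval, and the tube lemma
  makes the integrands uniformly close on it.\<close>

lemma continuous_map_parametric_integral:
  fixes f :: "'a \<Rightarrow> real \<Rightarrow> real"
  assumes f: "continuous_map (prod_topology X euclideanreal) euclideanreal (\<lambda>(x, t). f x t)"
    and supp: "\<And>x. x \<in> topspace X \<Longrightarrow>
      \<exists>U T. openin X U \<and> x \<in> U \<and> (\<forall>y\<in>U. \<forall>t. \<bar>t\<bar> > T \<longrightarrow> f y t = 0)"
  shows "continuous_map X euclideanreal (\<lambda>x. integral UNIV (f x))"
proof (rule continuous_map_euclideanrealI)
  fix x and e :: real assume x: "x \<in> topspace X" and e: "e > 0"
  have slice: "continuous_on UNIV (f y)" if "y \<in> topspace X" for y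
  proof -
    have "continuous_map euclideanreal (prod_topology X euclideanreal) (\<lambda>t. (y, t))"
      using that by (intro continuous_map_pairedI) auto
    from continuous_map_compose[OF this f] show ?thesis
      by (simp add: o_def)
  qed
  obtain U0 T0 where U0: "openin X U0" "x \<in> U0" "\<And>y t. y \<in> U0 \<Longrightarrow> \<bar>t\<bar> > T0 \<Longrightarrow> f y t = 0"
    using supp[OF x] by blast
  define T where "T = max T0 1"
  have T: "T > 0" "\<And>y t. y \<in> U0 \<Longrightarrow> \<bar>t\<bar> > T \<Longrightarrow> f y t = 0"
    using U0(3) by (auto simp: T_def)
  \<comment> \<open>The interval has length \<open>2 * T\<close>, so the integrals differ by at most
    \<open>e / 2\<close>.\<close>
  define e' where "e' = e / (4 * T)"
  have e': "e' > 0" using e T by (simp add: e'_def)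
  have "continuous_map (prod_topology X euclideanreal) euclideanreal (\<lambda>p. f x (snd p))"
    using continuous_map_compose[OF continuous_map_snd, of euclideanreal euclideanreal "f x" X] slice[OF x]
    by (simp add: o_def)
  with f have "continuous_map (prod_topology X euclideanreal) euclideanreal
      (\<lambda>p. (\<lambda>(x, t). f x t) p - f x (snd p))"
    by (intro continuous_map_diff)
  note diff = this
  define W where "W = {p \<in> topspace X \<times> UNIV. f (fst p) (snd p) - f x (snd p) \<in> {-e'<..<e'}}"
  have w1: "openin (prod_topology X euclideanreal) W"
    using openin_continuous_map_preimage[OF diff, of "{-e'<..<e'}"] by (simp add: W_def case_prod_beta)
  have w2: "compactin euclideanreal {-T..T}"
    by simp
  have w3: "{x} \<times> {-T..T} \<subseteq> W"
    using x e' by (auto simp: W_def)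
  obtain U V where UV: "openin X U" "x \<in> U" "{-T..T} \<subseteq> V" "U \<times> V \<subseteq> W"
    using tube_lemma_right[OF w1 w2 x w3] by blast
  have "\<bar>integral UNIV (f y) - integral UNIV (f x)\<bar> < e" if y: "y \<in> U \<inter> U0" for y
  proof -
    have yX: "y \<in> topspace X"
      using y openin_subset[OF UV(1)] by auto
    have int: "f z integrable_on {-T..T}" if "z \<in> topspace X" for z
      using slice[OF that] by (intro integrable_continuous_real) (auto intro: continuous_on_subset)
    have "integral UNIV (f y) = integral {-T..T} (f y)"
      using has_integral_bounded_support[OF slice[OF yX] T(2)] y by (intro integral_unique) auto
    moreover have "integral UNIV (f x) = integral {-T..T} (f x)"
      using has_integral_bounded_support[OF slice[OF x] T(2)] U0(2) by (intro integral_unique) auto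
    ultimately have "integral UNIV (f y) - integral UNIV (f x) = integral {-T..T} (\<lambda>t. f y t - f x t)"
      using int[OF x] int[OF yX] by (simp add: Henstock_Kurzweil_Integration.integral_diff)
    moreover have "norm (integral {-T..T} (\<lambda>t. f y t - f x t)) \<le> e' * (T - (-T))"
    proof (rule integral_bound)
      show "continuous_on {-T..T} (\<lambda>t. f y t - f x t)"
        using slice[OF x] slice[OF yX] by (intro continuous_on_diff) (auto intro: continuous_on_subset)
      show "norm (f y t - f x t) \<le> e'" if "t \<in> {-T..T}" for t
      proof -
        have "(y, t) \<in> W"
          using UV(3,4) y that by blast
        then show ?thesis
          by (simp add: W_def abs_le_iff)
      qed
    qed (use T in auto)
    moreover have "e' * (T - (-T)) < e"
      using e T by (simp add: e'_def)
    ultimately show ?thesis by simp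
  qed
  moreover have "openin X (U \<inter> U0)" "x \<in> U \<inter> U0"
    using UV U0 by auto
  ultimately show "\<exists>U. openin X U \<and> x \<in> U \<and> (\<forall>y\<in>U. \<bar>integral UNIV (f y) - integral UNIV (f x)\<bar> < e)"
    by blast
qed

section \<open>Flows near an isolated attractor\<close>

locale topological_flow =
  fixes M :: "'a topology" and \<phi> :: "'a \<Rightarrow> real \<Rightarrow> 'a"
  assumes flow: "continuous_flow M \<phi>"
    and Hausdorff: "Hausdorff_space M" and loc_compact: "locally_compact_space M"
    and normal: "normal_space M" and loc_path_connected: "locally_path_connected_space M"
begin

lemma continuous_map_flow: "continuous_map (prod_topology M euclideanreal) M (\<lambda>(x, t). \<phi> x t)"
  using flow by (simp add: continuous_flow_def)

lemma flow_zero: "x \<in> topspace M \<Longrightarrow> \<phi> x 0 = x"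
  and flow_add: "x \<in> topspace M \<Longrightarrow> \<phi> (\<phi> x s) t = \<phi> x (s + t)"
  using flow by (simp_all add: continuous_flow_def)

lemma continuous_map_flow_compose:
  assumes "continuous_map X M f" "continuous_map X euclideanreal u"
  shows "continuous_map X M (\<lambda>x. \<phi> (f x) (u x))"
  using continuous_map_compose[OF continuous_map_pairedI[OF assms] continuous_map_flow]
  by (simp add: o_def)

lemma flow_in_topspace: "x \<in> topspace M \<Longrightarrow> \<phi> x t \<in> topspace M"
  using continuous_map_image_subset_topspace[OF continuous_map_flow] by auto

lemma continuous_map_time: "continuous_map M M (\<lambda>x. \<phi> x t)"
  by (intro continuous_map_flow_compose) auto

lemma continuous_map_orbit: "x \<in> topspace M \<Longrightarrow> continuous_map euclideanreal M (\<phi> x)"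
  using continuous_map_flow_compose[of euclideanreal "\<lambda>t. x" "\<lambda>t. t"] by simp

lemma connectedin_orbit_image:
  "x \<in> topspace M \<Longrightarrow> connected I \<Longrightarrow> connectedin M (\<phi> x ` I)"
  by (intro connectedin_continuous_map_image[OF continuous_map_orbit]) auto

lemma compact_neighbourhood_within:
  assumes "compactin M Q" "openin M O'" "Q \<subseteq> O'"
  obtains U L where "openin M U" "compactin M L" "Q \<subseteq> U" "U \<subseteq> L" "L \<subseteq> O'"
proof -
  have "locally_compact_space (subtopology M O')"
    using assms(2) loc_compact Hausdorff
    by (intro locally_compact_space_open_subset) auto
  moreover have "Hausdorff_space (subtopology M O')"
    by (rule Hausdorff_space_subtopology[OF Hausdorff])
  moreover have "compactin (subtopology M O') Q"
    using assms by (simp add: compactin_subtopology)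
  ultimately obtain U L where "openin (subtopology M O') U" "compactin (subtopology M O') L" "Q \<subseteq> U" "U \<subseteq> L"
    using locally_compact_space_compact_closed_compact by meson
  then show ?thesis
    using assms(2) by (intro that[of U L]) (auto simp: compactin_subtopology openin_open_subtopology)
qed

text \<open>A time shift only shifts the tails of the orbit, and the two families of tails are
  cofinal in each other.\<close>

lemma omega_limit_flow:
  assumes x: "x \<in> topspace M"
  shows "omega_limit M \<phi> (\<phi> x s) = omega_limit M \<phi> x"
proof -
  have image: "\<phi> (\<phi> x s) ` {t..} = \<phi> x ` {s + t..}" for t
  proof -
    have "\<phi> (\<phi> x s) = (\<lambda>u. \<phi> x (s + u))"
      by (rule ext) (rule flow_add[OF x])
    moreover have "(\<lambda>u. \<phi> x (s + u)) ` {t..} = \<phi> x ` ((+) s ` {t..})"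
      by (simp only: image_image)
    ultimately show ?thesis by simp
  qed
  have "\<exists>t'\<ge>0. M closure_of (\<phi> x ` {s + t'..}) \<subseteq> M closure_of (\<phi> x ` {t..})" for t
    by (rule exI[of _ "max 0 (t - s)"]) (auto intro!: closure_of_mono)
  moreover have "\<exists>t'\<ge>0. M closure_of (\<phi> x ` {t'..}) \<subseteq> M closure_of (\<phi> x ` {s + t..})" for t
    by (rule exI[of _ "max 0 (s + t)"]) (auto intro!: closure_of_mono)
  ultimately show ?thesis
    unfolding omega_limit_def image by (intro equalityI INT_greatest; fastforce)
qed

end

locale attractor_flow = topological_flow +
  fixes K :: "'a set"
  assumes attractor: "isolated_attractor M \<phi> K"
    and internal: "only_internal_explosions M \<phi> K"
begin

abbreviation A where "A \<equiv> basin M \<phi> K"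
abbreviation C where "C \<equiv> A - K"

lemma isolated: "isolated_compact_invariant M \<phi> K"
  and K_interior_basin: "K \<subseteq> M interior_of A"
  using attractor unfolding isolated_attractor_def neighbourhood_of_set_def by blast+

lemma compact_K: "compactin M K"
  using isolated unfolding isolated_compact_invariant_def by blast

lemma invariant_K: "x \<in> K \<Longrightarrow> \<phi> x t \<in> K"
  using isolated unfolding isolated_compact_invariant_def invariant_set_def by blast

lemma K_subset: "K \<subseteq> topspace M"
  using compact_K by (rule compactin_subset_topspace)

lemma closed_K: "closedin M K"
  by (rule compactin_imp_closedin[OF Hausdorff compact_K])

lemma basin_subset: "A \<subseteq> topspace M"
  unfolding basin_def by blast

text \<open>Some \<omega>-limit point lies in \<open>K\<close>, and it is in the closure of every
  tail of the orbit.\<close>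

lemma eventually_frequently_near:
  assumes "x \<in> A" "openin M U" "K \<subseteq> U"
  obtains t where "t \<ge> T" "\<phi> x t \<in> U"
proof -
  obtain k where k: "k \<in> omega_limit M \<phi> x" "k \<in> K"
    using assms(1) by (auto simp: basin_def)
  then have "k \<in> M closure_of (\<phi> x ` {max 0 T..})"
    unfolding omega_limit_def by auto
  moreover have "k \<in> U"
    using k(2) assms(3) by blast
  ultimately have "\<exists>y\<in>\<phi> x ` {max 0 T..}. y \<in> U"
    using assms(2) unfolding in_closure_of by blast
  then show ?thesis using that by auto
qed

lemma basin_flow_iff:
  assumes "x \<in> topspace M"
  shows "\<phi> x t \<in> A \<longleftrightarrow> x \<in> A"
  unfolding basin_def mem_Collect_eq omega_limit_flow[OF assms]
  using assms flow_in_topspace[OF assms] by simp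

lemma K_flow_iff:
  assumes "x \<in> topspace M"
  shows "\<phi> x t \<in> K \<longleftrightarrow> x \<in> K"
proof
  assume "\<phi> x t \<in> K"
  then have "\<phi> (\<phi> x t) (- t) \<in> K"
    by (rule invariant_K)
  then show "x \<in> K"
    using assms by (simp add: flow_add flow_zero)
qed (rule invariant_K)

lemma C_topspace: "x \<in> C \<Longrightarrow> x \<in> topspace M"
  using basin_subset by blast

lemma flow_C: "x \<in> C \<Longrightarrow> \<phi> x t \<in> C"
  using basin_flow_iff[of x t] K_flow_iff[of x t] C_topspace[of x] by blast

lemma flow_inverse: "x \<in> topspace M \<Longrightarrow> \<phi> (\<phi> x t) (- t) = x"
  by (simp add: flow_add flow_zero)

text \<open>Some time map carries \<open>x\<close> into the interior of the basin; the preimage of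
  this interior is open and lies in the basin by invariance.\<close>

lemma openin_basin: "openin M A"
proof (subst openin_subopen, intro ballI)
  fix x assume x: "x \<in> A"
  obtain t where t: "\<phi> x t \<in> M interior_of A"
    using eventually_frequently_near[OF x openin_interior_of K_interior_basin] by blast
  have "openin M {y \<in> topspace M. \<phi> y t \<in> M interior_of A}"
    by (rule openin_continuous_map_preimage[OF continuous_map_time openin_interior_of])
  moreover have "{y \<in> topspace M. \<phi> y t \<in> M interior_of A} \<subseteq> A"
    using interior_of_subset[of M A] basin_flow_iff by blast
  moreover have "x \<in> {y \<in> topspace M. \<phi> y t \<in> M interior_of A}"
    using t x basin_subset by auto
  ultimately show "\<exists>T. openin M T \<and> x \<in> T \<and> T \<subseteq> A"
    by blast
qed

lemma K_subset_basin: "K \<subseteq> A"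
  using K_interior_basin interior_of_subset by (rule subset_trans)

lemma openin_C: "openin M C"
  using openin_basin closed_K by (rule openin_diff)

text \<open>
  The only use of the internal explosions: no point of \<open>Q\<close> lies in the prolongational limit set of
  a point of \<open>Q\<close>, and \<open>Q \<times> Q\<close> is compact.
\<close>

lemma no_return:
  assumes Q: "compactin M Q" "Q \<subseteq> C"
  obtains T where "T \<ge> 0" "\<forall>x\<in>Q. \<forall>t\<ge>T. \<phi> x t \<notin> Q"
proof -
  define wandering where "wandering W t \<longleftrightarrow> openin (prod_topology M M) W \<and> t \<ge> 0 \<and>
    (\<forall>x y s. (x, y) \<in> W \<longrightarrow> t \<le> s \<longrightarrow> \<phi> x s \<noteq> y)" for W t
  have "\<exists>W t. wandering W t \<and> (x, y) \<in> W" if xy: "x \<in> Q" "y \<in> Q" for x y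
  proof -
    have "y \<notin> prolongational_limit M \<phi> x"
      using internal xy Q(2) unfolding only_internal_explosions_def by blast
    then obtain U t where U: "openin M U" "x \<in> U" "t \<ge> 0"
      and y: "y \<notin> M closure_of {\<phi> z s | z s. z \<in> U \<and> t \<le> s}"
      unfolding prolongational_limit_def by blast
    have "y \<in> topspace M"
      using xy Q(2) C_topspace by blast
    then obtain V where V: "openin M V" "y \<in> V" "\<And>z. z \<in> {\<phi> z s | z s. z \<in> U \<and> t \<le> s} \<Longrightarrow> z \<notin> V"
      using y unfolding in_closure_of by blast
    have "wandering (U \<times> V) t"
      unfolding wandering_def using U V by (auto simp: openin_prod_Times_iff)
    then show ?thesis
      using U V by blast
  qed
  then have "Q \<times> Q \<subseteq> \<Union>{W. \<exists>t. wandering W t}"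
    by blast
  moreover have "compactin (prod_topology M M) (Q \<times> Q)"
    using Q by (simp add: compactin_Times)
  moreover have "\<And>W. W \<in> {W. \<exists>t. wandering W t} \<Longrightarrow> openin (prod_topology M M) W"
    by (auto simp: wandering_def)
  ultimately have "\<exists>\<F>. finite \<F> \<and> \<F> \<subseteq> {W. \<exists>t. wandering W t} \<and> Q \<times> Q \<subseteq> \<Union>\<F>"
    by (rule compactinD[rotated 2])
  then obtain \<F> where \<F>: "finite \<F>" "\<F> \<subseteq> {W. \<exists>t. wandering W t}" "Q \<times> Q \<subseteq> \<Union>\<F>"
    by blast
  then have "\<forall>W\<in>\<F>. \<exists>t. wandering W t"
    by blast
  then obtain \<tau> where \<tau>: "\<And>W. W \<in> \<F> \<Longrightarrow> wandering W (\<tau> W)"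
    by (auto dest!: bchoice)
  obtain T where T: "\<And>W. W \<in> \<F> \<Longrightarrow> \<tau> W \<le> T"
    using bdd_above_finite[OF finite_imageI[OF \<F>(1)], of \<tau>] unfolding bdd_above_def by auto
  show ?thesis
  proof (rule that[of "max T 0"]; (intro ballI allI impI)?)
    fix x t assume x: "x \<in> Q" and t: "max T 0 \<le> t"
    show "\<phi> x t \<notin> Q"
    proof
      assume "\<phi> x t \<in> Q"
      then obtain W where W: "W \<in> \<F>" "(x, \<phi> x t) \<in> W"
        using x \<F>(3) by blast
      have "\<tau> W \<le> t"
        using T[OF W(1)] t by simp
      then show False
        using \<tau>[OF W(1)] W(2) unfolding wandering_def by blast
    qed
  qed simp
qed

text \<open>An orbit in \<open>C\<close> enters \<open>U\<close> by attraction. It cannot stay in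
  \<open>L\<close>, because \<open>L\<close> lies in an isolating neighbourhood, where only the
  orbits of \<open>K\<close> stay for all time. Being connected, it meets the frontier.
  \<open>L\<close> itself need not be positively invariant.\<close>

lemma trapping_neighbourhood:
  assumes O': "openin M O'" "K \<subseteq> O'"
  obtains U L where "openin M U" "compactin M L" "K \<subseteq> U" "U \<subseteq> L" "L \<subseteq> O'"
    "compactin M (M frontier_of L)" "M frontier_of L \<subseteq> C"
    "\<forall>x\<in>C. \<exists>t. \<phi> x t \<in> M frontier_of L"
proof -
  obtain N where N: "compactin M N" "K \<subseteq> M interior_of N" "K = {x \<in> N. \<forall>t. \<phi> x t \<in> N}"
    using attractor
    unfolding isolated_attractor_def isolated_compact_invariant_def neighbourhood_of_set_def by blast
  have "openin M (O' \<inter> (A \<inter> M interior_of N))"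
    using O' openin_basin by (intro openin_Int openin_interior_of)
  moreover have "K \<subseteq> O' \<inter> (A \<inter> M interior_of N)"
    using O' N(2) K_subset_basin by blast
  ultimately obtain U L where UL: "openin M U" "compactin M L" "K \<subseteq> U" "U \<subseteq> L" "L \<subseteq> O' \<inter> (A \<inter> M interior_of N)"
    by (rule compact_neighbourhood_within[OF compact_K])
  have closed: "closedin M L"
    by (rule compactin_imp_closedin[OF Hausdorff UL(2)])
  then have sub: "M frontier_of L \<subseteq> L"
    by (rule frontier_of_subset_closedin)
  \<comment> \<open>\<open>U\<close> is open and inside \<open>L\<close>, so the frontier misses
    \<open>U\<close> and with it \<open>K\<close>; since \<open>L\<close> lies in the basin, the
    frontier lies in \<open>C\<close>.\<close>
  have "U \<inter> M frontier_of L = {}"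
    using frontier_of_openin_straddle_Int(2)[OF UL(1)] UL(4) by blast
  then have "M frontier_of L \<subseteq> C"
    using sub UL(3,5) by blast
  moreover have "compactin M (M frontier_of L)"
    using closed_compactin[OF UL(2) sub closedin_frontier_of] .
  moreover have "\<exists>t. \<phi> x t \<in> M frontier_of L" if x: "x \<in> C" for x
  proof -
    obtain t where "\<phi> x t \<in> U"
      using eventually_frequently_near[OF _ UL(1) UL(3), of x 0] x by blast
    then have "range (\<phi> x) \<inter> L \<noteq> {}"
      using UL(4) by blast
    moreover have "range (\<phi> x) - L \<noteq> {}"
    proof
      assume "range (\<phi> x) - L = {}"
      then have *: "\<phi> x t \<in> N" for t
        using UL(5) interior_of_subset[of M N] by blast
      have "x \<in> N"
        using *[of 0] x C_topspace by (simp add: flow_zero)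
      then show False
        using * N(3) x by blast
    qed
    moreover have "connectedin M (range (\<phi> x))"
      using x C_topspace by (intro connectedin_orbit_image) auto
    ultimately have "range (\<phi> x) \<inter> M frontier_of L \<noteq> {}"
      by (intro connectedin_Int_frontier_of)
    then show ?thesis by blast
  qed
  ultimately show ?thesis
    using UL by (intro that[of U L] ballI) blast+
qed

text \<open>
  \<open>- \<theta> x\<close> is the mean of \<open>t\<close> under the density \<open>\<bar>h (\<phi> x t)\<bar>\<close>, where \<open>h\<close> is a bump function supported in a
  compact part of \<open>C\<close>; by \<open>no_return\<close> each orbit meets the support only during a bounded time.
\<close>

lemma equivariant_time:
  obtains \<theta> where "continuous_map (subtopology M C) euclideanreal \<theta>"
    "\<And>x s. x \<in> C \<Longrightarrow> \<theta> (\<phi> x s) = \<theta> x + s"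
proof -
  obtain U0 L where "openin M U0" "compactin M L" "K \<subseteq> U0" "U0 \<subseteq> L" "L \<subseteq> topspace M"
      and P: "compactin M (M frontier_of L)" "M frontier_of L \<subseteq> C"
      and meets: "\<forall>x\<in>C. \<exists>t. \<phi> x t \<in> M frontier_of L"
    by (rule trapping_neighbourhood[OF openin_topspace K_subset])
  obtain U Q where UQ: "openin M U" "compactin M Q" "M frontier_of L \<subseteq> U" "U \<subseteq> Q" "Q \<subseteq> C"
    by (rule compact_neighbourhood_within[OF P(1) openin_C P(2)])
  have "closedin M (topspace M - U)" "closedin M (M frontier_of L)" "disjnt (topspace M - U) (M frontier_of L)"
    using UQ by (auto simp: closedin_frontier_of disjnt_def)
  then obtain h where h: "continuous_map M euclideanreal h" "h ` (topspace M - U) \<subseteq> {0}"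
    "h ` (M frontier_of L) \<subseteq> {1}"
    by (rule Urysohn_lemma_alt[OF normal])
  define G where "G x t = \<bar>h (\<phi> x t)\<bar>" for x t
  define I0 where "I0 x = integral UNIV (G x)" for x
  define I1 where "I1 x = integral UNIV (\<lambda>t. t * G x t)" for x
  have supp: "\<exists>V T. openin (subtopology M C) V \<and> x \<in> V \<and> (\<forall>y\<in>V. \<forall>t. \<bar>t\<bar> > T \<longrightarrow> G y t = 0)"
    if x: "x \<in> C" for x
  proof -
    have sing: "compactin M {x}" "{x} \<subseteq> C"
      using x C_topspace by auto
    obtain V Q' where V: "openin M V" "compactin M Q'" "{x} \<subseteq> V" "V \<subseteq> Q'" "Q' \<subseteq> C"
      by (rule compact_neighbourhood_within[OF sing(1) openin_C sing(2)])
    have un: "compactin M (Q \<union> Q')" "Q \<union> Q' \<subseteq> C"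
      using UQ V by (auto intro: compactin_Un)
    \<comment> \<open>Including the neighbourhood \<open>Q'\<close> of \<open>x\<close> in the
      compact set gives one bound for all nearby orbits and both time directions: a visit to
      \<open>Q\<close> at a time below \<open>- T\<close> would return to \<open>Q'\<close> too
      late.\<close>
    obtain T where T: "T \<ge> 0" "\<forall>x\<in>Q \<union> Q'. \<forall>t\<ge>T. \<phi> x t \<notin> Q \<union> Q'"
      by (rule no_return[OF un])
    have "G y t = 0" if y: "y \<in> V" and t: "\<bar>t\<bar> > T" for y t
    proof -
      have yC: "y \<in> C" "y \<in> topspace M"
        using y V(4,5) C_topspace by blast+
      have "\<phi> y t \<notin> Q"
      proof
        assume *: "\<phi> y t \<in> Q"
        show False
        proof (cases "t > T")
          case True
          then show False using T(2)[rule_format, of y t] y V(4) * by auto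
        next
          case False
          then have "- t \<ge> T" using t by auto
          then show False
            using T(2)[rule_format, of "\<phi> y t" "- t"] * y V(4) by (auto simp: flow_inverse[OF yC(2)])
        qed
      qed
      then have "\<phi> y t \<in> topspace M - U"
        using UQ(4) flow_in_topspace[OF yC(2)] by auto
      then show ?thesis
        using h(2) by (auto simp: G_def)
    qed
    then show ?thesis
      using V openin_open_subtopology[OF openin_C, of V] by (intro exI[of _ V] exI[of _ T]) blast
  qed
  have G_cont: "continuous_map (prod_topology (subtopology M C) euclideanreal) euclideanreal (\<lambda>(x, t). G x t)"
  proof -
    have "continuous_map (prod_topology (subtopology M C) euclideanreal) M (\<lambda>(x, t). \<phi> x t)"
      unfolding prod_topology_subtopology by (rule continuous_map_from_subtopology[OF continuous_map_flow])
    from continuous_map_compose[OF this h(1)]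
    show ?thesis
      unfolding G_def case_prod_beta o_def by (rule continuous_map_real_abs)
  qed
  have tG_cont: "continuous_map (prod_topology (subtopology M C) euclideanreal) euclideanreal (\<lambda>(x, t). t * G x t)"
    using continuous_map_real_mult[OF continuous_map_snd G_cont] unfolding case_prod_beta .
  have top: "topspace (subtopology M C) = C"
    using C_topspace by auto
  have supp': "\<exists>V T. openin (subtopology M C) V \<and> x \<in> V \<and> (\<forall>y\<in>V. \<forall>t. \<bar>t\<bar> > T \<longrightarrow> G y t = 0)"
    if "x \<in> topspace (subtopology M C)" for x
    by (rule supp) (use that in \<open>simp only: top\<close>)
  have I0_cont: "continuous_map (subtopology M C) euclideanreal I0"
    unfolding I0_def by (rule continuous_map_parametric_integral[OF G_cont supp'])
  have I1_cont: "continuous_map (subtopology M C) euclideanreal I1"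
    unfolding I1_def
  proof (rule continuous_map_parametric_integral[OF tG_cont])
    fix x assume x: "x \<in> topspace (subtopology M C)"
    obtain V T where "openin (subtopology M C) V" "x \<in> V" "\<forall>y\<in>V. \<forall>t. \<bar>t\<bar> > T \<longrightarrow> G y t = 0"
      using supp'[OF x] by blast
    then show "\<exists>V T. openin (subtopology M C) V \<and> x \<in> V \<and> (\<forall>y\<in>V. \<forall>t. \<bar>t\<bar> > T \<longrightarrow> t * G y t = 0)"
      by (intro exI[of _ V] exI[of _ T]) auto
  qed
  have slice: "continuous_on UNIV (G x)" if "x \<in> C" for x
  proof -
    have "continuous_map euclideanreal euclideanreal (\<lambda>t. \<bar>h (\<phi> x t)\<bar>)"
      using continuous_map_compose[OF continuous_map_orbit h(1)] that C_topspace
      by (intro continuous_map_real_abs) (auto simp: o_def)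
    then show ?thesis
      by (simp add: G_def[abs_def])
  qed
  have I0_pos: "I0 x > 0" if x: "x \<in> C" for x
  proof -
    obtain T where T: "\<And>t. \<bar>t\<bar> > T \<Longrightarrow> G x t = 0"
      using supp[OF x] by blast
    obtain t0 where t0: "\<phi> x t0 \<in> M frontier_of L"
      using meets x by blast
    then have G1: "G x t0 = 1"
      using h(3) by (auto simp: G_def)
    \<comment> \<open>The increment makes the interval nondegenerate, and it contains
      \<open>t0\<close> because the density is nonzero there.\<close>
    define S where "S = max T 0 + 1"
    have S: "\<And>t. \<bar>t\<bar> > S \<Longrightarrow> G x t = 0" "S > 0" "t0 \<in> {-S..S}"
      using T G1 T[of t0] by (auto simp: S_def abs_le_iff not_less[symmetric])
    have "I0 x = integral {-S..S} (G x)"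
      unfolding I0_def using has_integral_bounded_support[OF slice[OF x] S(1)] by (rule integral_unique)
    moreover have "integral {-S..S} (G x) \<ge> 0"
      by (rule integral_nonneg) (auto simp: G_def intro!: integrable_continuous_real
          continuous_on_subset[OF slice[OF x, unfolded G_def[abs_def]]])
    moreover have "integral {-S..S} (G x) \<noteq> 0"
    proof -
      have "continuous_on {-S..S} (G x)"
        using slice[OF x] by (rule continuous_on_subset) simp
      then have "integral {-S..S} (G x) = 0 \<longleftrightarrow> (\<forall>t\<in>{-S..S}. G x t = 0)"
        using S(2) by (intro integral_eq_0_iff) (auto simp: G_def)
      then show ?thesis
        using S(3) G1 by auto
    qed
    ultimately show ?thesis by simp
  qed
  \<comment> \<open>Substitute \<open>u = t + s\<close>: the total mass is unchanged, and the first
    moment drops by \<open>s\<close> times the mass. Hence \<open>- I1 / I0\<close> grows by exactly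
    \<open>s\<close>.\<close>
  have shift: "I0 (\<phi> x s) = I0 x \<and> I1 (\<phi> x s) = I1 x - s * I0 x" if x: "x \<in> C" for x s
  proof -
    obtain T where T: "\<And>t. \<bar>t\<bar> > T \<Longrightarrow> G x t = 0"
      using supp[OF x] by blast
    have G_shift: "G (\<phi> x s) t = G x (t + s)" for t
      using x C_topspace by (simp add: G_def flow_add add.commute)
    have i0: "(G x has_integral I0 x) UNIV"
      unfolding I0_def
      by (rule integrable_integral[OF has_integral_integrable[OF has_integral_bounded_support[OF slice[OF x] T]]])
    have ct: "continuous_on UNIV (\<lambda>t. t * G x t)"
      by (intro continuous_intros slice x)
    have i1: "((\<lambda>t. t * G x t) has_integral I1 x) UNIV"
      unfolding I1_def
      by (rule integrable_integral[OF has_integral_integrable[OF has_integral_bounded_support[OF ct, of T]]])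
        (simp add: T)
    have "((\<lambda>t. G x (t + s)) has_integral I0 x) UNIV"
      by (rule has_integral_shift_UNIV[OF slice[OF x] T i0])
    then have "I0 (\<phi> x s) = I0 x"
      unfolding I0_def[of "\<phi> x s"] by (simp add: G_shift[abs_def] integral_unique)
    moreover have "((\<lambda>u. u * G x u - s * G x u) has_integral I1 x - s * I0 x) UNIV"
      by (intro has_integral_diff i1 has_integral_mult_right i0)
    then have i2: "((\<lambda>u. (u - s) * G x u) has_integral I1 x - s * I0 x) UNIV"
      by (simp add: left_diff_distrib)
    have "((\<lambda>t. (t + s - s) * G x (t + s)) has_integral I1 x - s * I0 x) UNIV"
      by (rule has_integral_shift_UNIV[OF _ _ i2, of T])
        (auto simp: T intro!: continuous_intros slice x)
    then have "I1 (\<phi> x s) = I1 x - s * I0 x"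
      unfolding I1_def[of "\<phi> x s"] by (simp add: G_shift[abs_def] integral_unique)
    ultimately show ?thesis by simp
  qed
  show ?thesis
  proof (rule that[of "\<lambda>x. - I1 x / I0 x"])
    show "continuous_map (subtopology M C) euclideanreal (\<lambda>x. - I1 x / I0 x)"
      using I0_pos top by (intro continuous_map_real_divide continuous_map_minus I0_cont I1_cont) fastforce
    show "- I1 (\<phi> x s) / I0 (\<phi> x s) = - I1 x / I0 x + s" if "x \<in> C" for x s
      using shift[OF that, of s] I0_pos[OF that] by (simp add: field_simps)
  qed
qed

end

section \<open>Slabs and components of the punctured basin\<close>

locale attractor_time = attractor_flow +
  fixes \<theta> :: "'a \<Rightarrow> real"
  assumes continuous_time: "continuous_map (subtopology M C) euclideanreal \<theta>"
    and time_flow: "x \<in> C \<Longrightarrow> \<theta> (\<phi> x s) = \<theta> x + s"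
begin

lemma topspace_C: "topspace (subtopology M C) = C"
  using openin_subset[OF openin_C] by (rule topspace_subtopology_subset)

lemma openin_time_preimage:
  assumes "open V"
  shows "openin M {x \<in> C. \<theta> x \<in> V}"
proof -
  have "openin euclideanreal V"
    using assms by simp
  from openin_continuous_map_preimage[OF continuous_time this]
  have "openin (subtopology M C) {x \<in> C. \<theta> x \<in> V}"
    unfolding topspace_C .
  then show ?thesis
    by (rule openin_trans_full[OF _ openin_C])
qed

lemma time_bounded:
  assumes "compactin M Q" "Q \<subseteq> C"
  obtains b where "b > 0" "\<forall>x\<in>Q. \<bar>\<theta> x\<bar> < b"
proof -
  have "compactin (subtopology M C) Q"
    using assms by (simp add: compactin_subtopology)
  then have "compactin euclideanreal (\<theta> ` Q)"
    by (rule image_compactin[OF _ continuous_time])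
  then have "bounded (\<theta> ` Q)"
    by (simp add: compact_imp_bounded)
  then obtain b where b: "b > 0" "\<forall>y\<in>\<theta> ` Q. norm y < b"
    unfolding bounded_pos_less by blast
  then show ?thesis
    by (intro that[of b]) auto
qed

definition slab :: "real \<Rightarrow> 'a set" where
  "slab b = {x \<in> C. \<bar>\<theta> x\<bar> \<le> b}"

text \<open>Every orbit meets the compact frontier of a trapping neighbourhood, where \<theta> is
  bounded by \<open>B\<close>. So a point of the slab is reached from there within time
  \<open>B + b\<close>, and the slab lies in a compact subset \<open>E\<close> of \<open>C\<close>.
  Continuity of \<theta> alone gives closedness in \<open>C\<close>; through \<open>E\<close> the
  slab also stays away from \<open>K\<close>.\<close>

lemma compact_slab: "compactin M (slab b)"
proof -
  obtain U L where "openin M U" "compactin M L" "K \<subseteq> U" "U \<subseteq> L" "L \<subseteq> topspace M"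
    and P: "compactin M (M frontier_of L)" "M frontier_of L \<subseteq> C"
    and meets: "\<forall>x\<in>C. \<exists>t. \<phi> x t \<in> M frontier_of L"
    by (rule trapping_neighbourhood[OF openin_topspace K_subset])
  obtain B where B: "B > 0" "\<forall>x\<in>M frontier_of L. \<bar>\<theta> x\<bar> < B"
    by (rule time_bounded[OF P])
  define E where "E = (\<lambda>(x, t). \<phi> x t) ` ((M frontier_of L) \<times> {-(B + b)..B + b})"
  have "compactin M E"
    unfolding E_def
    by (rule image_compactin[OF _ continuous_map_flow]) (simp add: compactin_Times P)
  moreover have E_C: "E \<subseteq> C"
  proof
    fix p assume "p \<in> E"
    then obtain x t where "x \<in> M frontier_of L" "p = \<phi> x t"
      unfolding E_def by auto
    then show "p \<in> C"
      using flow_C[OF subsetD[OF P(2)]] by simp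
  qed
  ultimately have E: "compactin (subtopology M C) E"
    by (simp add: compactin_subtopology)
  have sub: "slab b \<subseteq> E"
  proof
    fix x assume "x \<in> slab b"
    then have x: "x \<in> C" "\<bar>\<theta> x\<bar> \<le> b"
      by (simp_all add: slab_def)
    obtain t where t: "\<phi> x t \<in> M frontier_of L"
      using meets x(1) by blast
    then have "\<bar>\<theta> x + t\<bar> < B"
      using B(2) time_flow[OF x(1), of t] by auto
    then have "- t \<in> {-(B + b)..B + b}"
      using x(2) by auto
    moreover have "x = \<phi> (\<phi> x t) (- t)"
      using flow_inverse[OF C_topspace[OF x(1)]] by simp
    ultimately have "\<exists>p\<in>(M frontier_of L) \<times> {-(B + b)..B + b}. x = (\<lambda>(x, t). \<phi> x t) p"
      using t by (intro bexI[of _ "(\<phi> x t, - t)"]) auto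
    then show "x \<in> E"
      unfolding E_def by blast
  qed
  have closed: "closedin euclideanreal {-b..b}"
    by simp
  have "closedin (subtopology M C) {x \<in> C. \<theta> x \<in> {-b..b}}"
    using closedin_continuous_map_preimage[OF continuous_time closed] unfolding topspace_C .
  moreover have "{x \<in> C. \<theta> x \<in> {-b..b}} = slab b"
    by (auto simp: slab_def)
  ultimately have "compactin (subtopology M C) (slab b)"
    using closed_compactin[OF E sub] by simp
  then show ?thesis
    by (simp add: compactin_subtopology)
qed

lemma closedin_slab: "closedin M (slab b)"
  by (rule compactin_imp_closedin[OF Hausdorff compact_slab])

lemma slab_disjoint_K: "K \<inter> slab b = {}"
  by (auto simp: slab_def)

abbreviation components where "components \<equiv> connected_components_of (subtopology M C)"

lemma component_subset: "X \<in> components \<Longrightarrow> X \<subseteq> C"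
  using connected_components_of_subset[of X "subtopology M C"] by (simp only: topspace_C)

lemma openin_component:
  assumes "X \<in> components"
  shows "openin M X"
proof -
  have "locally_connected_space M"
    by (rule locally_path_connected_imp_locally_connected_space[OF loc_path_connected])
  then show ?thesis
    using locally_connected_space_open_connected_components openin_C assms by blast
qed

lemma components_disjoint:
  assumes "X \<in> components" "Y \<in> components" "x \<in> X" "x \<in> Y"
  shows "X = Y"
  using connected_components_of_overlap[OF assms(1,2)] IntI[OF assms(3,4)] by (metis empty_iff)

lemma component_flow:
  assumes X: "X \<in> components" and x: "x \<in> X"
  shows "\<phi> x t \<in> X"
proof -
  have xC: "x \<in> C"
    using X x component_subset by blast
  have "connectedin M (range (\<phi> x))"
    by (rule connectedin_orbit_image[OF C_topspace[OF xC]]) simp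
  moreover have "range (\<phi> x) \<subseteq> C"
    using flow_C[OF xC] by blast
  ultimately have "connectedin (subtopology M C) (range (\<phi> x))"
    by (simp add: connectedin_subtopology)
  moreover have "x \<in> range (\<phi> x)"
    using flow_zero[OF C_topspace[OF xC]] by (metis rangeI)
  then have "\<not> disjnt X (range (\<phi> x))"
    using x by (auto simp: disjnt_iff)
  ultimately have "range (\<phi> x) \<subseteq> X"
    by (rule connected_components_of_maximal[OF X])
  then show ?thesis by blast
qed

text \<open>Components are open and invariant, and every orbit crosses the compact section
  \<open>slab 0\<close>. Finitely many of them cover the section, and no further one can
  exist.\<close>

lemma finite_components: "finite components"
proof -
  have "slab 0 \<subseteq> \<Union>components"
    unfolding Union_connected_components_of topspace_C by (auto simp: slab_def)
  from compactinD[OF compact_slab openin_component this]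
  obtain \<F> where \<F>: "finite \<F>" "\<F> \<subseteq> components" "slab 0 \<subseteq> \<Union>\<F>"
    by blast
  have "X \<in> \<F>" if X: "X \<in> components" for X
  proof -
    obtain x where x: "x \<in> X"
      using nonempty_connected_components_of[OF X] by blast
    then have "x \<in> C"
      using component_subset[OF X] by blast
    then have "\<phi> x (- \<theta> x) \<in> slab 0"
      using time_flow flow_C by (simp add: slab_def)
    then obtain Y where Y: "Y \<in> \<F>" "\<phi> x (- \<theta> x) \<in> Y"
      using \<F>(3) by blast
    then have "X = Y"
      using components_disjoint[OF X _ component_flow[OF X x]] \<F>(2) by blast
    then show ?thesis using Y by simp
  qed
  then show ?thesis
    using \<F>(1) by (intro finite_subset[of components \<F>]) auto
qed

text \<open>The component comes out of \<open>K\<close>: it has points arbitrarily near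
  \<open>K\<close> at arbitrarily early times. A different point may be taken for each
  \<open>W\<close> and \<open>T\<close>; \<open>emanates_backward\<close> upgrades this to every
  single orbit of the component.\<close>

definition emanates :: "'a set \<Rightarrow> bool" where
  "emanates X \<longleftrightarrow> (\<forall>W T. openin M W \<longrightarrow> K \<subseteq> W \<longrightarrow> (\<exists>z\<in>W \<inter> X. \<theta> z < - T))"

text \<open>
  Below the level \<open>-b\<close> the component is connected and misses the frontier of a trapping
  neighbourhood, so it lies inside this neighbourhood as soon as it meets it.
\<close>

lemma emanates_backward:
  assumes X: "X \<in> components" and em: "emanates X" and y: "y \<in> X" and W: "openin M W" "K \<subseteq> W"
  obtains T where "\<forall>t\<ge>T. \<phi> y (- t) \<in> W"
proof -
  obtain U L where U: "openin M U" and "compactin M L" and UL: "K \<subseteq> U" "U \<subseteq> L" "L \<subseteq> W"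
    and P: "compactin M (M frontier_of L)" "M frontier_of L \<subseteq> C"
    and meets: "\<forall>x\<in>C. \<exists>t. \<phi> x t \<in> M frontier_of L"
    by (rule trapping_neighbourhood[OF W])
  obtain b where b: "b > 0" "\<forall>x\<in>M frontier_of L. \<bar>\<theta> x\<bar> < b"
    by (rule time_bounded[OF P])
  define X' where "X' = {x \<in> X. \<theta> x < - b}"
  have XC: "x \<in> C" if "x \<in> X" for x
    using component_subset[OF X] that by blast
  \<comment> \<open>\<open>f\<close> moves a point along its orbit to a prescribed level of
    \<theta>, which exhibits \<open>X'\<close> as a continuous image of the connected set
    \<open>X \<times> {..<- b}\<close>.\<close>
  define f where "f = (\<lambda>p. \<phi> (fst p) (snd p - \<theta> (fst p)))"
  have "continuous_map (prod_topology (subtopology M C) euclideanreal) M f"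
    unfolding f_def
  proof (intro continuous_map_flow_compose continuous_map_diff continuous_map_snd)
    show "continuous_map (prod_topology (subtopology M C) euclideanreal) M fst"
      by (rule continuous_map_into_fulltopology[OF continuous_map_fst])
    show "continuous_map (prod_topology (subtopology M C) euclideanreal) euclideanreal (\<lambda>p. \<theta> (fst p))"
      using continuous_map_compose[OF continuous_map_fst continuous_time] by (simp add: o_def)
  qed
  moreover have "connectedin (prod_topology (subtopology M C) euclideanreal) (X \<times> {..<- b})"
    using connectedin_connected_components_of[OF X] by (simp add: connectedin_Times)
  ultimately have "connectedin M (f ` (X \<times> {..<- b}))"
    by (rule connectedin_continuous_map_image)
  moreover have "f ` (X \<times> {..<- b}) = X'"
  proof
    show "f ` (X \<times> {..<- b}) \<subseteq> X'"
      using component_flow[OF X] time_flow[OF XC] by (auto simp: f_def X'_def)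
    show "X' \<subseteq> f ` (X \<times> {..<- b})"
    proof
      fix x assume "x \<in> X'"
      then have "x \<in> X" "\<theta> x < - b"
        by (auto simp: X'_def)
      moreover from this have "f (x, \<theta> x) = x"
        using flow_zero[OF C_topspace[OF XC]] by (simp add: f_def)
      ultimately show "x \<in> f ` (X \<times> {..<- b})"
        by (intro image_eqI[of _ _ "(x, \<theta> x)"]) auto
    qed
  qed
  ultimately have conn: "connectedin M X'"
    by simp
  obtain z where z: "z \<in> U \<inter> X" "\<theta> z < - b"
    using em U UL(1) unfolding emanates_def by blast
  then have "X' \<inter> L \<noteq> {}"
    using UL(2) by (auto simp: X'_def)
  moreover have "X' \<inter> M frontier_of L = {}"
    using b(2) by (fastforce simp: X'_def)
  ultimately have "X' - L = {}"
    using connectedin_Int_frontier_of[OF conn] by blast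
  then have X'W: "X' \<subseteq> W"
    using UL(3) by blast
  show ?thesis
  proof (rule that[of "\<theta> y + b + 1"], intro allI impI)
    fix t assume "\<theta> y + b + 1 \<le> t"
    then have "\<phi> y (- t) \<in> X'"
      using component_flow[OF X y] time_flow[OF XC[OF y]] by (simp add: X'_def)
    then show "\<phi> y (- t) \<in> W"
      using X'W by blast
  qed
qed

text \<open>If \<open>y\<close> were outside the hull, compactness of \<open>K\<close> would give
  one neighbourhood of \<open>K\<close> and one time after which no orbit starting there passes
  through \<open>y\<close>. But the backward orbit of \<open>y\<close> enters this neighbourhood and
  stays, and it returns to \<open>y\<close> after an arbitrarily long time.\<close>

lemma emanates_homoclinic:
  assumes X: "X \<in> components" and em: "emanates X"
  shows "X \<in> homoclinic_components M \<phi> K"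
proof -
  have "y \<in> prolongation_hull M \<phi> K" if y: "y \<in> X" for y
  proof (rule ccontr)
    assume no: "y \<notin> prolongation_hull M \<phi> K"
    have yC: "y \<in> C"
      using component_subset[OF X] y by blast
    define far where "far U t \<longleftrightarrow> openin M U \<and> (\<forall>z\<in>U. \<forall>s\<ge>t. \<phi> z s \<noteq> y)" for U t
    have "\<exists>U t. far U t \<and> k \<in> U" if k: "k \<in> K" for k
    proof -
      have "y \<notin> prolongational_limit M \<phi> k"
        using no k unfolding prolongation_hull_def by blast
      then obtain U t where U: "openin M U" "k \<in> U"
        and cl: "y \<notin> M closure_of {\<phi> z s | z s. z \<in> U \<and> t \<le> s}"
        unfolding prolongational_limit_def by blast
      have "{\<phi> z s | z s. z \<in> U \<and> t \<le> s} \<subseteq> topspace M"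
        using openin_subset[OF U(1)] flow_in_topspace by blast
      then have "y \<notin> {\<phi> z s | z s. z \<in> U \<and> t \<le> s}"
        using cl closure_of_subset by blast
      then have "far U t"
        using U unfolding far_def by blast
      then show ?thesis using U by blast
    qed
    then have "K \<subseteq> \<Union>{U. \<exists>t. far U t}"
      by blast
    moreover have "openin M U" if "U \<in> {U. \<exists>t. far U t}" for U
      using that unfolding far_def by blast
    ultimately obtain \<F> where \<F>: "finite \<F>" "\<F> \<subseteq> {U. \<exists>t. far U t}" "K \<subseteq> \<Union>\<F>"
      using compactinD[OF compact_K, of "{U. \<exists>t. far U t}"] by blast
    then have "\<forall>U\<in>\<F>. \<exists>t. far U t"
      by blast
    then obtain \<tau> where \<tau>: "\<forall>U\<in>\<F>. far U (\<tau> U)"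
      by (auto dest!: bchoice)
    obtain T where T: "\<And>U. U \<in> \<F> \<Longrightarrow> \<tau> U \<le> T"
      using bdd_above_finite[OF finite_imageI[OF \<F>(1)], of \<tau>] unfolding bdd_above_def by auto
    have open_F: "openin M (\<Union>\<F>)"
      using \<tau> unfolding far_def by (intro openin_Union) blast
    obtain T' where T': "\<forall>t\<ge>T'. \<phi> y (- t) \<in> \<Union>\<F>"
      by (rule emanates_backward[OF X em y open_F \<F>(3)])
    define t where "t = max T T'"
    have "\<phi> y (- t) \<in> \<Union>\<F>"
      using T' by (simp add: t_def)
    then obtain U where U: "U \<in> \<F>" "\<phi> y (- t) \<in> U"
      by blast
    have "\<tau> U \<le> t"
      using T[OF U(1)] by (simp add: t_def)
    then have "\<phi> (\<phi> y (- t)) t \<noteq> y"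
      using \<tau> U unfolding far_def by blast
    moreover have "\<phi> (\<phi> y (- t)) t = y"
      using flow_inverse[OF C_topspace[OF yC], of "- t"] by simp
    ultimately show False by blast
  qed
  then show ?thesis
    using X unfolding homoclinic_components_def by blast
qed

text \<open>A component that does not emanate has \<theta> bounded below near \<open>K\<close>. As
  there are finitely many components, one neighbourhood \<open>V\<close> of \<open>K\<close> and one
  bound \<open>- T\<close> serve for all of them.\<close>

lemma unstable_imp_emanates:
  assumes unstable: "\<not> stable_set M \<phi> K"
  shows "\<exists>X\<in>components. emanates X"
proof (rule ccontr)
  assume not_ex: "\<not> (\<exists>X\<in>components. emanates X)"
  have no: "\<not> emanates X" if "X \<in> components" for X
    using not_ex that by blast
  define barred where "barred X p \<longleftrightarrow> openin M (fst p) \<and> K \<subseteq> fst p \<and> (\<forall>z\<in>fst p \<inter> X. \<theta> z \<ge> - snd p)"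
    for X and p :: "'a set \<times> real"
  have "\<forall>X\<in>components. \<exists>p. barred X p"
  proof
    fix X assume "X \<in> components"
    then obtain W T where "openin M W" "K \<subseteq> W" "\<not> (\<exists>z\<in>W \<inter> X. \<theta> z < - T)"
      using no[of X] unfolding emanates_def by blast
    then have "barred X (W, T)"
      unfolding barred_def by (simp add: not_less)
    then show "\<exists>p. barred X p" by blast
  qed
  then obtain p where p: "\<forall>X\<in>components. barred X (p X)"
    by (auto dest!: bchoice)
  define W \<tau> where "W X = fst (p X)" and "\<tau> X = snd (p X)" for X
  have W: "\<forall>X\<in>components. openin M (W X) \<and> K \<subseteq> W X \<and> (\<forall>z\<in>W X \<inter> X. \<theta> z \<ge> - \<tau> X)"
    using p unfolding barred_def W_def \<tau>_def .
  obtain T where T: "\<And>X. X \<in> components \<Longrightarrow> \<tau> X \<le> T"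
    using bdd_above_finite[OF finite_imageI[OF finite_components], of \<tau>] unfolding bdd_above_def by auto
  define V where "V = A \<inter> \<Inter>(W ` components)"
  have V_open: "openin M V"
    unfolding V_def using finite_components openin_basin W by (intro openin_Int_Inter) auto
  have K_V: "K \<subseteq> V"
    unfolding V_def using K_subset_basin W by blast
  have V_time: "\<theta> z \<ge> - T" if z: "z \<in> V" "z \<in> C" for z
  proof -
    have "z \<in> \<Union>components"
      unfolding Union_connected_components_of topspace_C by (rule z(2))
    then obtain X where X: "X \<in> components" "z \<in> X"
      by blast
    then have "\<theta> z \<ge> - \<tau> X"
      using W z(1) unfolding V_def by blast
    then show ?thesis
      using T[OF X(1)] by simp
  qed
  have "stable_set M \<phi> K"
    unfolding stable_set_def
  proof (intro allI impI)
    fix N assume "neighbourhood_of_set M K N"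
    then have KN: "K \<subseteq> M interior_of N"
      by (simp add: neighbourhood_of_set_def)
    obtain U L where U: "openin M U" and "compactin M L" and UL: "K \<subseteq> U" "U \<subseteq> L" "L \<subseteq> M interior_of N"
      and P: "compactin M (M frontier_of L)" "M frontier_of L \<subseteq> C"
      and meets: "\<forall>x\<in>C. \<exists>t. \<phi> x t \<in> M frontier_of L"
      by (rule trapping_neighbourhood[OF openin_interior_of KN])
    obtain b where b: "b > 0" "\<forall>x\<in>M frontier_of L. \<bar>\<theta> x\<bar> < b"
      by (rule time_bounded[OF P])
    \<comment> \<open>\<open>b\<close> keeps the set where \<theta> exceeds \<open>m\<close> inside
      \<open>L\<close>. \<open>T\<close> excludes times below \<open>- m\<close> in
      \<open>V\<close>, so that \<open>V - slab m\<close> is contained in \<open>P0\<close>; this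
      difference is open and contains \<open>K\<close> because the slab is closed and misses
      \<open>K\<close>.\<close>
    define m where "m = max T b"
    define P0 where "P0 = K \<union> {x \<in> C. \<theta> x > m}"
    have "x \<in> N" if x: "x \<in> C" "\<theta> x > m" for x
    proof -
      \<comment> \<open>Otherwise the forward orbit, which still has to enter \<open>U\<close>,
        would cross the frontier at a time below \<open>b\<close>, yet \<theta> starts above
        \<open>b\<close> and increases.\<close>
      have "x \<in> L"
      proof (rule ccontr)
        assume "x \<notin> L"
        moreover have "x \<in> \<phi> x ` {0..}"
          using flow_zero[OF C_topspace[OF x(1)]] by (intro image_eqI[of _ _ 0]) auto
        ultimately have "\<phi> x ` {0..} - L \<noteq> {}"
          by blast
        moreover have xA: "x \<in> A"
          using x(1) by blast
        obtain t where "t \<ge> 0" "\<phi> x t \<in> U"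
          by (rule eventually_frequently_near[OF xA U UL(1)])
        then have "\<phi> x ` {0..} \<inter> L \<noteq> {}"
          using UL(2) by auto
        moreover have "connectedin M (\<phi> x ` {0..})"
          by (rule connectedin_orbit_image[OF C_topspace[OF x(1)]]) simp
        ultimately have "\<phi> x ` {0..} \<inter> M frontier_of L \<noteq> {}"
          by (intro connectedin_Int_frontier_of)
        then obtain s where s: "s \<ge> 0" "\<phi> x s \<in> M frontier_of L"
          by auto
        then have "\<bar>\<theta> x + s\<bar> < b"
          using b(2) time_flow[OF x(1), of s] by auto
        then show False
          using x(2) s(1) unfolding m_def by auto
      qed
      then show ?thesis
        using UL(3) interior_of_subset[of M N] by blast
    qed
    moreover have "K \<subseteq> N"
      using KN interior_of_subset[of M N] by blast
    ultimately have P0_N: "P0 \<subseteq> N"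
      unfolding P0_def by blast
    have P0_top: "P0 \<subseteq> topspace M"
      unfolding P0_def using K_subset C_topspace by blast
    have "V - slab m \<subseteq> P0"
    proof
      fix x assume x: "x \<in> V - slab m"
      show "x \<in> P0"
      proof (cases "x \<in> K")
        case False
        then have xC: "x \<in> C"
          using x unfolding V_def by blast
        then have "\<theta> x \<ge> - T" "\<not> \<bar>\<theta> x\<bar> \<le> m"
          using x V_time unfolding slab_def by blast+
        then have "\<theta> x > m"
          unfolding m_def by auto
        then show ?thesis
          using xC unfolding P0_def by blast
      qed (simp add: P0_def)
    qed
    moreover have "openin M (V - slab m)"
      by (rule openin_diff[OF V_open closedin_slab])
    moreover have "K \<subseteq> V - slab m"
      using K_V slab_disjoint_K by blast
    ultimately have "K \<subseteq> M interior_of P0"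
      using interior_of_maximal by blast
    then have nbd: "neighbourhood_of_set M K P0"
      using P0_top by (simp add: neighbourhood_of_set_def)
    have "\<phi> x t \<in> P0" if "x \<in> P0" "t \<ge> 0" for x t
    proof (cases "x \<in> K")
      case True
      then show ?thesis
        using invariant_K unfolding P0_def by blast
    next
      case False
      then have "x \<in> C" "\<theta> x > m"
        using that unfolding P0_def by blast+
      then show ?thesis
        using flow_C[of x t] time_flow[of x t] that(2) unfolding P0_def by auto
    qed
    then have "positively_invariant_set M \<phi> P0"
      using P0_top by (simp add: positively_invariant_set_def)
    then show "\<exists>P\<subseteq>N. neighbourhood_of_set M K P \<and> positively_invariant_set M \<phi> P"
      using nbd P0_N by blast
  qed
  then show False
    using unstable by blast
qed

text \<open>\<open>W\<close>, the path component of \<open>k\<close> off the slab, is open and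
  contains \<open>K\<close> since \<open>K\<close> is connected. As \<open>y\<close> is in the
  prolongational limit of \<open>k\<close>, some orbit starts in \<open>W\<close>, passes close to
  \<open>y\<close> much later and so belongs to \<open>X\<close>; attraction brings it back to
  \<open>W\<close>, where its ends can be joined.\<close>

lemma homoclinic_loop:
  assumes conn_K: "connectedin M K" and X: "X \<in> homoclinic_components M \<phi> K"
  obtains z t and \<delta> :: "real \<Rightarrow> 'a" where "z \<in> X" "\<theta> z < - 1" "\<theta> z + t > 1" "t \<ge> 0"
    "continuous_map (top_of_set {0..1}) M \<delta>" "\<delta> ` {0..1} \<subseteq> topspace M - slab 1"
    "\<delta> 0 = \<phi> z t" "\<delta> 1 = z"
proof -
  have Xc: "X \<in> components" and X_hull: "X \<subseteq> prolongation_hull M \<phi> K"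
    using X unfolding homoclinic_components_def by blast+
  obtain y where y: "y \<in> X"
    using nonempty_connected_components_of[OF Xc] by blast
  then obtain k where k: "k \<in> K" "y \<in> prolongational_limit M \<phi> k"
    using X_hull unfolding prolongation_hull_def by blast
  define E where "E = topspace M - slab 1"
  have E_open: "openin M E"
    unfolding E_def by (rule openin_diff[OF openin_topspace closedin_slab])
  have K_E: "K \<subseteq> E"
    using K_subset slab_disjoint_K unfolding E_def by blast
  have lpc: "locally_path_connected_space (subtopology M E)"
    by (rule locally_path_connected_space_open_subset[OF loc_path_connected E_open])
  define W where "W = path_component_of_set (subtopology M E) k"
  have "openin (subtopology M E) W"
    unfolding W_def by (rule openin_path_component_of_locally_path_connected_space[OF lpc])
  then have W_open: "openin M W"
    by (rule openin_trans_full[OF _ E_open])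
  have "connectedin (subtopology M E) K"
    using conn_K K_E by (simp add: connectedin_subtopology)
  from connected_component_of_maximal[OF this k(1)]
  have K_W: "K \<subseteq> W"
    unfolding W_def path_component_eq_connected_component_of[OF lpc] .
  have XC: "x \<in> C" if "x \<in> X" for x
    using component_subset[OF Xc] that by blast
  \<comment> \<open>The point \<open>z\<close> found below satisfies
    \<open>\<theta> z < \<theta> y + 1 - s0\<close>, which is at most -2.\<close>
  define s0 where "s0 = \<bar>\<theta> y\<bar> + 3"
  have meet: "\<exists>p\<in>S. p \<in> O'" if "y \<in> M closure_of S" "openin M O'" "y \<in> O'" for S O'
    using that by (meson in_closure_of)
  have "y \<in> M closure_of {\<phi> w s | w s. w \<in> W \<and> s0 \<le> s}"
    using k K_W W_open unfolding prolongational_limit_def s0_def by auto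
  moreover have "openin M (X \<inter> {x \<in> C. \<theta> x \<in> {..<\<theta> y + 1}})"
    by (intro openin_Int openin_component[OF Xc] openin_time_preimage open_lessThan)
  moreover have "y \<in> X \<inter> {x \<in> C. \<theta> x \<in> {..<\<theta> y + 1}}"
    using y XC by auto
  ultimately have "\<exists>p\<in>{\<phi> w s | w s. w \<in> W \<and> s0 \<le> s}. p \<in> X \<inter> {x \<in> C. \<theta> x \<in> {..<\<theta> y + 1}}"
    by (rule meet)
  then obtain z s where zs: "z \<in> W" "s0 \<le> s" "\<phi> z s \<in> X" "\<theta> (\<phi> z s) < \<theta> y + 1"
    by auto
  have "z \<in> topspace M"
    using zs(1) openin_subset[OF W_open] by blast
  then have "z = \<phi> (\<phi> z s) (- s)"
    by (simp add: flow_inverse)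
  then have zX: "z \<in> X"
    using component_flow[OF Xc zs(3), of "- s"] by simp
  then have z_time: "\<theta> z < - 1"
    using zs(2,4) time_flow[OF XC, of z s] unfolding s0_def by auto
  have zA: "z \<in> A"
    using XC[OF zX] by blast
  \<comment> \<open>The bound puts the end of the orbit piece at time at least 2, beyond the
    slab.\<close>
  obtain t where t: "t \<ge> 2 - \<theta> z" "\<phi> z t \<in> W"
    by (rule eventually_frequently_near[OF zA W_open K_W])
  have "path_component_of (subtopology M E) (\<phi> z t) z"
    using zs(1) t(2) unfolding W_def
    by (metis mem_Collect_eq path_component_of_sym path_component_of_trans)
  then obtain \<delta> where \<delta>: "pathin (subtopology M E) \<delta>" "\<delta> 0 = \<phi> z t" "\<delta> 1 = z"
    unfolding path_component_of_def by blast
  have \<delta>_cont: "continuous_map (top_of_set {0..1}) M \<delta>" and \<delta>_E: "\<delta> ` {0..1} \<subseteq> E"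
    using \<delta>(1) unfolding pathin_def continuous_map_in_subtopology by auto
  show ?thesis
    using zX z_time t(1) \<delta>_cont \<delta>_E \<delta>(2,3) unfolding E_def
    by (intro that[of z t \<delta>]) auto
qed

end

section \<open>Homoclinic components and their classes\<close>

lemma locally_compact_manifold:
  assumes "topological_manifold n M"
  shows "locally_compact_space M"
  unfolding locally_compact_space_def
proof
  fix x assume x: "x \<in> topspace M"
  then obtain U where U: "openin M U" "x \<in> U" "subtopology M U homeomorphic_space Euclidean_space n"
    using assms unfolding topological_manifold_def by blast
  then have "locally_compact_space (subtopology M U)"
    using homeomorphic_locally_compact_space locally_compact_Euclidean_space by blast
  moreover have "x \<in> topspace (subtopology M U)"
    using U x by simp
  ultimately obtain V L where "openin (subtopology M U) V" "compactin (subtopology M U) L" "x \<in> V" "V \<subseteq> L"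
    unfolding locally_compact_space_def by blast
  then show "\<exists>V L. openin M V \<and> compactin M L \<and> x \<in> V \<and> V \<subseteq> L"
    using openin_trans_full[OF _ U(1)] by (auto simp: compactin_subtopology)
qed

lemma locally_path_connected_manifold:
  assumes "topological_manifold n M"
  shows "locally_path_connected_space M"
  unfolding locally_path_connected_space
proof (intro allI impI, elim conjE)
  fix V x assume V: "openin M V" "x \<in> V"
  then have "x \<in> topspace M"
    using openin_subset by blast
  then obtain U where U: "openin M U" "x \<in> U" "subtopology M U homeomorphic_space Euclidean_space n"
    using assms unfolding topological_manifold_def by blast
  then have "locally_path_connected_space (subtopology M U)"
    using homeomorphic_locally_path_connected_space locally_path_connected_Euclidean_space by blast
  moreover have "openin (subtopology M U) (U \<inter> V)" "x \<in> U \<inter> V"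
    using U V by (auto simp: openin_subtopology_Int2)
  ultimately obtain W where "openin (subtopology M U) W" "path_connectedin (subtopology M U) W" "x \<in> W" "W \<subseteq> U \<inter> V"
    unfolding locally_path_connected_space by meson
  then show "\<exists>W. openin M W \<and> path_connectedin M W \<and> x \<in> W \<and> W \<subseteq> V"
    using openin_trans_full[OF _ U(1)] by (intro exI[of _ W]) (auto simp: path_connectedin_subtopology)
qed

section \<open>Crossing numbers of the sections\<close>

context attractor_time
begin

text \<open>In a tube the two sides of a section are told apart by \<theta>; off the slab no section
  is met. Tubes may stick out of the slab, and then \<open>jump_off_slab\<close> reconciles the two
  descriptions.\<close>

definition tube_cover :: "'a set set" where
  "tube_cover = insert (topspace M - slab 1)
     ((\<lambda>(X, t). X \<inter> {x \<in> C. \<theta> x \<in> {t - 1/2<..<t + 1/2}}) ` (components \<times> UNIV))"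

definition side :: "('i \<Rightarrow> 'a set) \<Rightarrow> 'i \<Rightarrow> 'a \<Rightarrow> 'r::comm_ring_1" where
  "side h i x = (if x \<in> h i \<and> 0 \<le> \<theta> x then 1 else 0)"

text \<open>The tests make the jump a function of the two points alone, whichever cover set contains
  them. Without the bound on times, two points near \<open>K\<close> on opposite sides of the
  section would count as a crossing, and the closing path of a loop could undo the crossing of its
  orbit piece.\<close>

definition jump :: "('i \<Rightarrow> 'a set) \<Rightarrow> 'i \<Rightarrow> 'a \<Rightarrow> 'a \<Rightarrow> 'r::comm_ring_1" where
  "jump h i p q = (if p \<in> h i \<and> q \<in> h i \<and> \<bar>\<theta> p - \<theta> q\<bar> < 1 then side h i q - side h i p else 0)"

lemma jump_same_component:
  assumes h: "h i \<in> components" and X: "X \<in> components" and "p \<in> X" "q \<in> X" "\<bar>\<theta> p - \<theta> q\<bar> < 1"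
  shows "jump h i p q = side h i q - side h i p"
proof (cases "h i = X")
  case True
  then show ?thesis
    using assms by (simp add: jump_def)
next
  case False
  then have "p \<notin> h i" "q \<notin> h i"
    using components_disjoint[OF h X] assms by blast+
  then show ?thesis
    by (simp add: jump_def side_def)
qed

text \<open>Two times of absolute value above 1 that differ by less than 1 have the same
  sign.\<close>

lemma jump_off_slab:
  assumes h: "h i \<in> components" and "p \<notin> slab 1" "q \<notin> slab 1"
  shows "jump h i p q = 0"
proof (cases "p \<in> h i \<and> q \<in> h i \<and> \<bar>\<theta> p - \<theta> q\<bar> < 1")
  case True
  then have "\<bar>\<theta> p\<bar> > 1" "\<bar>\<theta> q\<bar> > 1"
    using assms component_subset[OF h] by (auto simp: slab_def not_le)
  then have "0 \<le> \<theta> p \<longleftrightarrow> 0 \<le> \<theta> q"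
    using True by (auto simp: abs_if split: if_splits)
  then show ?thesis
    using True by (simp add: jump_def side_def)
qed (auto simp: jump_def)

lemma tube_cover_cases:
  assumes "V \<in> tube_cover"
  obtains "V = topspace M - slab 1"
    | X where "X \<in> components" "V \<subseteq> X" "\<forall>p\<in>V. \<forall>q\<in>V. \<bar>\<theta> p - \<theta> q\<bar> < 1"
proof -
  consider "V = topspace M - slab 1"
    | X t where "X \<in> components" "V = X \<inter> {x \<in> C. \<theta> x \<in> {t - 1/2<..<t + 1/2}}"
    using assms unfolding tube_cover_def by auto
  then show ?thesis
  proof cases
    case 2
    show ?thesis
    proof (rule that(2)[OF 2(1)])
      show "V \<subseteq> X"
        unfolding 2(2) by (rule Int_lower1)
      show "\<forall>p\<in>V. \<forall>q\<in>V. \<bar>\<theta> p - \<theta> q\<bar> < 1"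
        unfolding 2(2) by (auto simp: abs_less_iff)
    qed
  qed (rule that(1))
qed

lemma jump_system_jump:
  fixes I :: "'i set"
  assumes h: "\<And>i. i \<in> I \<Longrightarrow> h i \<in> components"
  shows "jump_system M tube_cover I (side h) (jump h :: 'i \<Rightarrow> 'a \<Rightarrow> 'a \<Rightarrow> 'r::comm_ring_1)"
proof
  fix V assume V: "V \<in> tube_cover"
  consider "V = topspace M - slab 1"
    | X t where "X \<in> components" "V = X \<inter> {x \<in> C. \<theta> x \<in> {t - 1/2<..<t + 1/2}}"
    using V unfolding tube_cover_def by auto
  then show "openin M V"
  proof cases
    case 1
    then show ?thesis
      using openin_diff[OF openin_topspace closedin_slab] by simp
  next
    case 2
    show ?thesis
      unfolding 2(2) by (intro openin_Int openin_component[OF 2(1)] openin_time_preimage open_greaterThanLessThan)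
  qed
next
  show "topspace M \<subseteq> \<Union>tube_cover"
  proof
    fix x assume x: "x \<in> topspace M"
    show "x \<in> \<Union>tube_cover"
    proof (cases "x \<in> slab 1")
      case True
      then have xC: "x \<in> C"
        by (simp add: slab_def)
      then have "x \<in> \<Union>components"
        unfolding Union_connected_components_of topspace_C .
      then obtain X where X: "X \<in> components" "x \<in> X"
        by blast
      have "X \<inter> {y \<in> C. \<theta> y \<in> {\<theta> x - 1/2<..<\<theta> x + 1/2}} \<in> tube_cover"
        unfolding tube_cover_def using X(1) by (intro insertI2 image_eqI[of _ _ "(X, \<theta> x)"]) auto
      moreover have "x \<in> X \<inter> {y \<in> C. \<theta> y \<in> {\<theta> x - 1/2<..<\<theta> x + 1/2}}"
        using X(2) xC by simp
      ultimately show ?thesis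
        by (rule UnionI)
    next
      case False
      then show ?thesis
        using x by (intro UnionI[of "topspace M - slab 1"]) (auto simp: tube_cover_def)
    qed
  qed
next
  fix V i p q t assume V: "V \<in> tube_cover" and i: "i \<in> I" and inV: "p \<in> V" "q \<in> V" "t \<in> V"
  from V show "jump h i p q + jump h i q t = (jump h i p t :: 'r)"
  proof (cases rule: tube_cover_cases)
    case 1
    have "jump h i x y = (0 :: 'r)" if "x \<in> V" "y \<in> V" for x y
      by (rule jump_off_slab[of h i, OF h[OF i]]) (use that 1 in auto)
    then show ?thesis
      using inV by simp
  next
    case (2 X)
    then have "jump h i p q = (side h i q - side h i p :: 'r)" "jump h i q t = (side h i t - side h i q :: 'r)"
      "jump h i p t = (side h i t - side h i p :: 'r)"
      using inV by (auto intro!: jump_same_component[of h i X, OF h[OF i] 2(1)])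
    then show ?thesis by simp
  qed
next
  fix V i j p q t assume V: "V \<in> tube_cover" and i: "i \<in> I" and j: "j \<in> I" and inV: "p \<in> V" "q \<in> V" "t \<in> V"
  from V show "jump h i p q * jump h j q t = (side h i q - side h i p) * (jump h j q t :: 'r)"
  proof (cases rule: tube_cover_cases)
    case 1
    \<comment> \<open>Off the slab \<open>side h i\<close> may differ between \<open>p\<close> and
      \<open>q\<close> although no jump is recorded; the vanishing second factor hides this
      discrepancy.\<close>
    then have "jump h j q t = (0 :: 'r)"
      using inV by (intro jump_off_slab[of h j, OF h[OF j]]) auto
    then show ?thesis by simp
  next
    case (2 X)
    then have "jump h i p q = (side h i q - side h i p :: 'r)"
      using inV by (auto intro!: jump_same_component[of h i X, OF h[OF i] 2(1)])
    then show ?thesis by simp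
  qed
qed

text \<open>Along the orbit \<open>side h j\<close> is itself a primitive of the jumps, because
  close parameters give points of one component at close times. On \<open>h k\<close> it rises from
  0 before the section to 1 after it; for any other component it stays 0.\<close>

lemma crossing_orbit:
  fixes I :: "'i set"
  assumes h: "\<And>i. i \<in> I \<Longrightarrow> h i \<in> components" and inj: "inj_on h I" and k: "k \<in> I" and j: "j \<in> I"
    and z: "z \<in> h k" "\<theta> z < - 1" "\<theta> z + t > 1" "t \<ge> 0"
  shows "jump_system.crossing (jump h) j (\<lambda>u. \<phi> z (u * t)) = (if j = k then 1 else 0 :: 'r::comm_ring_1)"
proof -
  interpret J: jump_system M tube_cover I "side h" "jump h :: 'i \<Rightarrow> 'a \<Rightarrow> 'a \<Rightarrow> 'r"
    by (rule jump_system_jump[OF h])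
  let ?\<gamma> = "\<lambda>u. \<phi> z (u * t)"
  have zC: "z \<in> C"
    using component_subset[OF h[OF k]] z(1) by blast
  have inX: "?\<gamma> u \<in> h k" for u
    by (rule component_flow[OF h[OF k] z(1)])
  have time: "\<theta> (?\<gamma> u) = \<theta> z + u * t" for u
    by (rule time_flow[OF zC])
  have "local_primitive {0..1} (\<lambda>x y. jump h j (?\<gamma> x) (?\<gamma> y)) (\<lambda>u. side h j (?\<gamma> u) :: 'r)"
    unfolding local_primitive_def
  \<comment> \<open>Parameters in such a ball are less than \<open>1 / (t + 1)\<close> apart, hence
    the times less than 1 apart; the added 1 covers \<open>t = 0\<close>.\<close>
  proof (intro ballI exI[of _ "1 / (2 * (t + 1))"] conjI)
    fix x p q :: real assume pq: "p \<in> {0..1} \<inter> ball x (1 / (2 * (t + 1)))" "q \<in> {0..1} \<inter> ball x (1 / (2 * (t + 1)))"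
    have "dist p q < 1 / (2 * (t + 1)) + 1 / (2 * (t + 1))"
      using pq dist_triangle3[of p q x] by auto
    also have "\<dots> = 1 / (t + 1)"
      using z(4) by (simp add: field_simps)
    finally have "\<bar>p - q\<bar> * (t + 1) < 1"
      using z(4) by (simp add: dist_real_def field_simps)
    moreover have "\<bar>p - q\<bar> * t \<le> \<bar>p - q\<bar> * (t + 1)"
      by (simp add: algebra_simps)
    ultimately have "\<bar>(p - q) * t\<bar> < 1"
      using z(4) by (simp add: abs_mult)
    then have "\<bar>\<theta> (?\<gamma> p) - \<theta> (?\<gamma> q)\<bar> < 1"
      by (simp add: time left_diff_distrib)
    then show "side h j (?\<gamma> q) - side h j (?\<gamma> p) = (jump h j (?\<gamma> p) (?\<gamma> q) :: 'r)"
      by (rule jump_same_component[of h j "h k", OF h[OF j] h[OF k] inX inX, symmetric])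
  qed (use z(4) in auto)
  then have "J.crossing j ?\<gamma> = side h j (?\<gamma> 1) - side h j (?\<gamma> 0)"
    by (rule J.crossing_eq)
  moreover have "side h j (?\<gamma> 0) = (0 :: 'r)"
    using time[of 0] z(2) by (simp add: side_def)
  moreover have "side h j (?\<gamma> 1) = (if j = k then 1 else 0 :: 'r)"
  proof (cases "j = k")
    case True
    then show ?thesis
      using time[of 1] z(3) inX[of 1] by (simp add: side_def)
  next
    case False
    then have "h j \<noteq> h k"
      using inj j k by (auto simp: inj_on_def)
    then have "?\<gamma> 1 \<notin> h j"
      using components_disjoint[OF h[OF j] h[OF k] _ inX[of 1]] by blast
    then show ?thesis
      using False by (simp add: side_def)
  qed
  ultimately show ?thesis by simp
qed

text \<open>All jumps along the path vanish, so a constant is a primitive.\<close>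

lemma crossing_off_slab:
  fixes I :: "'i set" and \<delta> :: "real \<Rightarrow> 'a"
  assumes h: "\<And>i. i \<in> I \<Longrightarrow> h i \<in> components" and j: "j \<in> I"
    and \<delta>: "\<delta> ` {0..1} \<subseteq> topspace M - slab 1"
  shows "jump_system.crossing (jump h) j \<delta> = (0 :: 'r::comm_ring_1)"
proof -
  interpret J: jump_system M tube_cover I "side h" "jump h :: 'i \<Rightarrow> 'a \<Rightarrow> 'a \<Rightarrow> 'r"
    by (rule jump_system_jump[OF h])
  have "jump h j (\<delta> p) (\<delta> q) = (0 :: 'r)" if "p \<in> {0..1}" "q \<in> {0..1}" for p q
    using \<delta> that by (intro jump_off_slab[of h j, OF h[OF j]]) blast+
  then have "local_primitive {0..1} (\<lambda>x y. jump h j (\<delta> x) (\<delta> y)) (\<lambda>u. 0 :: 'r)"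
    unfolding local_primitive_def by (auto intro!: exI[of _ 1])
  from J.crossing_eq[OF this] show ?thesis by simp
qed

lemma homoclinic_classes:
  assumes conn_K: "connectedin M K" and unstable: "\<not> stable_set M \<phi> K"
    and r: "r = card (homoclinic_components M \<phi> K)"
  shows "1 \<le> r \<and>
    (\<exists>\<alpha> :: nat \<Rightarrow> ('a sing_simplex \<Rightarrow> 'r::comm_ring_1) set.
       (\<forall>i\<in>{1..r}. \<alpha> i \<in> carrier (singular_cohomology 1 M)) \<and>
       module_independent (singular_cohomology 1 M) {1..r} \<alpha> \<and>
       (\<forall>i\<in>{1..r}. \<forall>j\<in>{1..r}.
          cup_product 1 1 M (\<alpha> i) (\<alpha> j) = \<zero>\<^bsub>singular_cohomology 2 M\<^esub>))"
proof
  let ?H = "homoclinic_components M \<phi> K"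
  have sub: "?H \<subseteq> components"
    unfolding homoclinic_components_def by blast
  then have fin: "finite ?H"
    using finite_components by (rule finite_subset)
  have "?H \<noteq> {}"
    using unstable_imp_emanates[OF unstable] emanates_homoclinic by blast
  then have "card ?H \<noteq> 0"
    using fin by simp
  then show "1 \<le> r"
    unfolding r by simp
  obtain h where bij: "bij_betw h {1..r} ?H"
    using ex_bij_betw_nat_finite_1[OF fin] unfolding r by blast
  have hH: "h i \<in> ?H" if "i \<in> {1..r}" for i
    using bij that by (rule bij_betwE[rule_format])
  then have h: "h i \<in> components" if "i \<in> {1..r}" for i
    using sub that by blast
  have inj: "inj_on h {1..r}"
    using bij by (rule bij_betw_imp_inj_on)
  interpret J: jump_system M tube_cover "{1..r}" "side h" "jump h :: nat \<Rightarrow> 'a \<Rightarrow> 'a \<Rightarrow> 'r"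
    by (rule jump_system_jump[OF h])
  let ?\<alpha> = "\<lambda>i. cohomology_class 1 M (J.crossing_cochain i)"
  have "module_independent (singular_cohomology 1 M) {1..r} ?\<alpha>"
  proof (rule J.independent_crossing_cochain)
    fix i assume i: "i \<in> {1..r}"
    obtain z t and \<delta> :: "real \<Rightarrow> 'a" where z: "z \<in> h i" "\<theta> z < - 1" "\<theta> z + t > 1" "t \<ge> 0"
      and \<delta>: "continuous_map (top_of_set {0..1}) M \<delta>" "\<delta> ` {0..1} \<subseteq> topspace M - slab 1"
      "\<delta> 0 = \<phi> z t" "\<delta> 1 = z"
      by (rule homoclinic_loop[OF conn_K hH[OF i]])
    have zM: "z \<in> topspace M"
      using C_topspace[OF subsetD[OF component_subset[OF h[OF i]] z(1)]] .
    let ?\<gamma> = "\<lambda>u. \<phi> z (u * t)"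
    have "continuous_map (top_of_set {0..1}) M ?\<gamma>"
      by (rule continuous_map_flow_compose) (auto simp: zM intro!: continuous_intros)
    moreover have "J.crossing j ?\<gamma> + J.crossing j \<delta> = (if j = i then 1 else 0)" if j: "j \<in> {1..r}" for j
      using crossing_orbit[where 'r = 'r, OF h inj i j z] crossing_off_slab[where 'r = 'r, OF h j \<delta>(2)] by simp
    ultimately show "\<exists>\<gamma> \<delta>. continuous_map (top_of_set {0..1}) M \<gamma> \<and> continuous_map (top_of_set {0..1}) M \<delta> \<and>
        \<delta> 0 = \<gamma> 1 \<and> \<delta> 1 = \<gamma> 0 \<and> (\<forall>j\<in>{1..r}. J.crossing j \<gamma> + J.crossing j \<delta> = (if j = i then 1 else 0))"
      using \<delta> flow_zero[OF zM] by (intro exI[of _ ?\<gamma>] exI[of _ \<delta>]) simp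
  qed
  moreover have "\<forall>i\<in>{1..r}. ?\<alpha> i \<in> carrier (singular_cohomology 1 M)"
    unfolding singular_cohomology_simps by (intro ballI imageI J.crossing_cochain_cocycle)
  moreover have "\<forall>i\<in>{1..r}. \<forall>j\<in>{1..r}. cup_product 1 1 M (?\<alpha> i) (?\<alpha> j) = \<zero>\<^bsub>singular_cohomology 2 M\<^esub>"
    by (intro ballI J.cup_crossing_cochain)
  ultimately show "\<exists>\<alpha> :: nat \<Rightarrow> ('a sing_simplex \<Rightarrow> 'r) set.
       (\<forall>i\<in>{1..r}. \<alpha> i \<in> carrier (singular_cohomology 1 M)) \<and>
       module_independent (singular_cohomology 1 M) {1..r} \<alpha> \<and>
       (\<forall>i\<in>{1..r}. \<forall>j\<in>{1..r}.
          cup_product 1 1 M (\<alpha> i) (\<alpha> j) = \<zero>\<^bsub>singular_cohomology 2 M\<^esub>)"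
    by (intro exI[of _ ?\<alpha>] conjI)
qed

end

theorem theorem17:
  fixes M :: "'a topology" and \<phi> :: "'a \<Rightarrow> real \<Rightarrow> 'a" and K :: "'a set" and n r :: nat
  assumes "topological_manifold n M"
    and "R_orientable TYPE('r::comm_ring_1) n M"
    and "continuous_flow M \<phi>"
    and "K \<subseteq> topspace M"
    and "connectedin M K"
    and "isolated_attractor M \<phi> K"
    and "\<not> stable_set M \<phi> K"
    and "only_internal_explosions M \<phi> K"
    and "r = card (homoclinic_components M \<phi> K)"
  shows "1 \<le> r \<and>
    (\<exists>\<alpha> :: nat \<Rightarrow> ('a sing_simplex \<Rightarrow> 'r) set.
       (\<forall>i\<in>{1..r}. \<alpha> i \<in> carrier (singular_cohomology 1 M)) \<and>
       module_independent (singular_cohomology 1 M) {1..r} \<alpha> \<and>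
       (\<forall>i\<in>{1..r}. \<forall>j\<in>{1..r}.
          cup_product 1 1 M (\<alpha> i) (\<alpha> j) = \<zero>\<^bsub>singular_cohomology 2 M\<^esub>))"
proof -
  have "metrizable_space M"
    using assms(1) by (simp add: topological_manifold_def)
  then interpret attractor_flow M \<phi> K
    using assms locally_compact_manifold[OF assms(1)] locally_path_connected_manifold[OF assms(1)]
    by unfold_locales (auto intro: metrizable_imp_Hausdorff_space metrizable_imp_normal_space)
  obtain \<theta> where \<theta>: "continuous_map (subtopology M C) euclideanreal \<theta>"
    "\<And>x s. x \<in> C \<Longrightarrow> \<theta> (\<phi> x s) = \<theta> x + s"
    by (rule equivariant_time) blast
  interpret attractor_time M \<phi> K \<theta>
    by unfold_locales (rule \<theta>, erule \<theta>(2))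
  show ?thesis
    by (rule homoclinic_classes[OF assms(5,7,9)])
qed

end
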